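(* For every $d\ge1$ and every prime $p$, the sequence $\{a_d(p^k)\}_{k\ge1}$ converges $p$-adically to an element $\kappa_d^{(p)}\in1+p\mathbb{Z}_p$, with $a_d(p^k)\equiv\kappa_d^{(p)}\pmod{p^k}$ for every $k\ge1$. If, in addition, $p\in\mathrm{Tame}_d$, then $\nu_p(\kappa_d^{(p)}-1)=\nu_p(a_d(p)-1)$.
   Context: For integers $d,n\ge1$, $T_d(n)$ is the Cayley graph of $(\mathbb{Z}/n\mathbb{Z})^d$ with respect to $\{\pm e_1,\dots,\pm e_d\}\setminus\{0\}$ ($e_i$ the standard basis vectors); it is a simple graph. $a_d(n)$ is the number of independent sets of $T_d(n)$ (including the empty set). $\nu_p$ is the $p$-adic valuation on $\mathbb{Q}_p$ with $\nu_p(p)=1$. A prime $p$ is tame with respect to $d$ if $\nu_p(a_d(p^k)-1)=\nu_p(a_d(p)-1)$ for every $k\ge1$; $\mathrm{Tame}_d$ is the set of such primes. *)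

theory Defs
  imports "HOL-Algebra.QuotRing" "HOL-Algebra.Product_Groups" "HOL-Computational_Algebra.Primes"
    "HOL-Library.Extended_Real"
begin

section \<open>The field of $p$-adic numbers\<close>

definition rat_pval :: "nat \<Rightarrow> rat \<Rightarrow> ereal" where
  "rat_pval p q = (if q = 0 then \<infinity> else
     ereal (real (multiplicity (int p) (fst (quotient_of q)))
          - real (multiplicity (int p) (snd (quotient_of q)))))"

definition padic_Cauchy :: "nat \<Rightarrow> (nat \<Rightarrow> rat) \<Rightarrow> bool" where
  "padic_Cauchy p X \<longleftrightarrow>
     (\<forall>r::real. \<exists>N. \<forall>i\<ge>N. \<forall>j\<ge>N. rat_pval p (X i - X j) \<ge> ereal r)"

definition padic_Cauchy_ring :: "nat \<Rightarrow> (nat \<Rightarrow> rat) ring" where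
  "padic_Cauchy_ring p =
     \<lparr>carrier = {X. padic_Cauchy p X},
      monoid.mult = (\<lambda>X Y n. X n * Y n), one = (\<lambda>_. 1),
      zero = (\<lambda>_. 0), add = (\<lambda>X Y n. X n + Y n)\<rparr>"

definition padic_null :: "nat \<Rightarrow> (nat \<Rightarrow> rat) set" where
  "padic_null p = {X. (\<lambda>n. rat_pval p (X n)) \<longlonglongrightarrow> \<infinity>}"

text \<open>The completion of the rationals: Cauchy sequences modulo null sequences.\<close>

definition Qp :: "nat \<Rightarrow> (nat \<Rightarrow> rat) set ring" where
  "Qp p = padic_Cauchy_ring p Quot padic_null p"

definition padic_of_rat :: "nat \<Rightarrow> rat \<Rightarrow> (nat \<Rightarrow> rat) set" where
  "padic_of_rat p q = padic_null p +>\<^bsub>padic_Cauchy_ring p\<^esub> (\<lambda>_. q)"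

text \<open>
  The extension of the valuation by continuity. An element of \<open>Qp p\<close> is the set of all
  Cauchy sequences representing it, and the limit does not depend on the representative
  (\<open>padic_val_eqI\<close> below).
\<close>

definition padic_val :: "nat \<Rightarrow> (nat \<Rightarrow> rat) set \<Rightarrow> ereal" where
  "padic_val p x = (THE v. \<forall>X\<in>x. (\<lambda>n. rat_pval p (X n)) \<longlonglongrightarrow> v)"

definition Zp :: "nat \<Rightarrow> (nat \<Rightarrow> rat) set set" where
  "Zp p = {x \<in> carrier (Qp p). padic_val p x \<ge> 0}"

text \<open>The ideal $p^k \mathbb{Z}_p$, as a subset of \<open>carrier (Qp p)\<close>.\<close>

definition pow_Zp :: "nat \<Rightarrow> nat \<Rightarrow> (nat \<Rightarrow> rat) set set" where
  "pow_Zp p k = padic_of_rat p (of_nat (p ^ k)) <#\<^bsub>Qp p\<^esub> Zp p"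

definition padic_cong :: "nat \<Rightarrow> nat \<Rightarrow> (nat \<Rightarrow> rat) set \<Rightarrow> (nat \<Rightarrow> rat) set \<Rightarrow> bool" where
  "padic_cong p k x y \<longleftrightarrow> x \<in> Zp p \<and> y \<in> Zp p \<and> x \<ominus>\<^bsub>Qp p\<^esub> y \<in> pow_Zp p k"

definition padic_tendsto :: "nat \<Rightarrow> (nat \<Rightarrow> (nat \<Rightarrow> rat) set) \<Rightarrow> (nat \<Rightarrow> rat) set \<Rightarrow> bool" where
  "padic_tendsto p x y \<longleftrightarrow>
     range x \<subseteq> carrier (Qp p) \<and> y \<in> carrier (Qp p) \<and>
     (\<lambda>k. padic_val p (x k \<ominus>\<^bsub>Qp p\<^esub> y)) \<longlonglongrightarrow> \<infinity>"

subsection \<open>Well-definedness\<close>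

lemma rat_pval_0 [simp]: "rat_pval p 0 = \<infinity>"
  by (simp add: rat_pval_def)

lemma rat_pval_fract:
  assumes "prime p" "a \<noteq> 0" "b \<noteq> 0"
  shows "rat_pval p (of_int a / of_int b) =
    ereal (real (multiplicity (int p) a) - real (multiplicity (int p) b))"
proof -
  let ?q = "of_int a / of_int b :: rat"
  obtain c d where q: "quotient_of ?q = (c, d)" by (cases "quotient_of ?q")
  have d: "d > 0" using quotient_of_denom_pos[OF q] .
  have "?q = of_int c / of_int d" using quotient_of_div[OF q] .
  then have "of_int (a * d) = (of_int (c * b) :: rat)"
    using assms d by (simp add: field_simps)
  then have e: "a * d = c * b" by (simp only: of_int_eq_iff)
  have "c \<noteq> 0" using e assms d by auto
  have pr: "prime_elem (int p)" using assms(1) by auto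
  have "multiplicity (int p) a + multiplicity (int p) d
      = multiplicity (int p) c + multiplicity (int p) b"
    using arg_cong[OF e, of "multiplicity (int p)"] pr assms d \<open>c \<noteq> 0\<close>
    by (simp add: prime_elem_multiplicity_mult_distrib)
  then have "real (multiplicity (int p) a) + real (multiplicity (int p) d)
      = real (multiplicity (int p) c) + real (multiplicity (int p) b)"
    by (metis of_nat_add)
  moreover have "?q \<noteq> 0" using assms by simp
  ultimately show ?thesis by (simp add: rat_pval_def q)
qed

lemma rat_pval_of_int:
  assumes "prime p" "a \<noteq> 0"
  shows "rat_pval p (of_int a) = ereal (real (multiplicity (int p) a))"
  using rat_pval_fract[OF assms, of 1] by simp

lemma rat_as_fract:
  obtains a b :: int where "b \<noteq> 0" "(q::rat) = of_int a / of_int b"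
  by (metis Fract_of_int_quotient Rat_cases less_irrefl)

lemma rat_pval_mult:
  assumes "prime p"
  shows "rat_pval p (x * y) = rat_pval p x + rat_pval p y"
proof (cases "x = 0 \<or> y = 0")
  case True
  then show ?thesis by (auto simp: rat_pval_def)
next
  case False
  obtain a b where x: "b \<noteq> 0" "x = of_int a / of_int b" by (rule rat_as_fract)
  obtain c d where y: "d \<noteq> 0" "y = of_int c / of_int d" by (rule rat_as_fract)
  have nz: "a \<noteq> 0" "c \<noteq> 0" using False x y by auto
  have pr: "prime_elem (int p)" using assms by auto
  have "x * y = of_int (a * c) / of_int (b * d)" using x y by simp
  then have "rat_pval p (x * y) = ereal (real (multiplicity (int p) (a * c))
      - real (multiplicity (int p) (b * d)))"
    using rat_pval_fract[OF assms, of "a * c" "b * d"] x y nz by simp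
  then show ?thesis
    using rat_pval_fract[OF assms, of a b] rat_pval_fract[OF assms, of c d] x y nz pr
    by (simp add: prime_elem_multiplicity_mult_distrib)
qed

lemma rat_pval_minus [simp]: "rat_pval p (- x) = rat_pval p x"
proof -
  have "multiplicity (int p) (- a) = multiplicity (int p) a" for a
    by (simp add: multiplicity_def)
  then show ?thesis
    by (simp add: rat_pval_def rat_uminus_code Let_def case_prod_unfold)
qed

lemma rat_pval_diff_commute: "rat_pval p (x - y) = rat_pval p (y - x)"
  by (metis minus_diff_eq rat_pval_minus)

lemma rat_pval_add:
  assumes "prime p"
  shows "min (rat_pval p x) (rat_pval p y) \<le> rat_pval p (x + y)"
proof (cases "x = 0 \<or> y = 0 \<or> x + y = 0")
  case True
  then show ?thesis by auto
next
  case False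
  obtain a b where x: "b \<noteq> 0" "x = of_int a / of_int b" by (rule rat_as_fract)
  obtain c d where y: "d \<noteq> 0" "y = of_int c / of_int d" by (rule rat_as_fract)
  have nz: "a \<noteq> 0" "c \<noteq> 0" using False x y by auto
  have pr: "prime_elem (int p)" using assms by auto
  have x': "x = of_int (a * d) / of_int (b * d)" and y': "y = of_int (c * b) / of_int (b * d)"
    using x y by simp_all
  have s: "x + y = of_int (a * d + c * b) / of_int (b * d)"
    using x y by (simp add: field_simps)
  have sn: "a * d + c * b \<noteq> 0" using False s by (metis div_0 of_int_0)
  let ?m = "multiplicity (int p)"
  have "int p ^ min (?m (a * d)) (?m (c * b)) dvd a * d + c * b"
    by (intro dvd_add multiplicity_dvd') auto
  then have "min (?m (a * d)) (?m (c * b)) \<le> ?m (a * d + c * b)"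
    using sn pr by (intro multiplicity_geI) auto
  then have "min (real (?m (a * d))) (real (?m (c * b))) \<le> real (?m (a * d + c * b))"
    by linarith
  then show ?thesis
    using rat_pval_fract[OF assms, of "a * d" "b * d", folded x']
      rat_pval_fract[OF assms, of "c * b" "b * d", folded y']
      rat_pval_fract[OF assms sn, of "b * d", folded s] x(1) y(1) nz
    by (auto simp: min_def split: if_splits)
qed

lemma rat_pval_add_ge:
  assumes "prime p" "e \<le> rat_pval p x" "e \<le> rat_pval p y"
  shows "e \<le> rat_pval p (x + y)"
  using rat_pval_add[OF assms(1), of x y] assms(2,3) by (meson min.bounded_iff order_trans)

lemma padic_null_iff:
  "X \<in> padic_null p \<longleftrightarrow> (\<forall>r::real. \<exists>N. \<forall>n\<ge>N. ereal r \<le> rat_pval p (X n))"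
proof -
  have "X \<in> padic_null p \<longleftrightarrow> (\<forall>r::real. \<exists>N. \<forall>n\<ge>N. ereal r < rat_pval p (X n))"
    by (simp add: padic_null_def tendsto_PInfty eventually_sequentially)
  also have "\<dots> \<longleftrightarrow> (\<forall>r::real. \<exists>N. \<forall>n\<ge>N. ereal r \<le> rat_pval p (X n))"
  proof (intro iffI allI)
    fix r :: real
    assume "\<forall>r::real. \<exists>N. \<forall>n\<ge>N. ereal r \<le> rat_pval p (X n)"
    then obtain N where N: "\<forall>n\<ge>N. ereal (r + 1) \<le> rat_pval p (X n)" by blast
    have "ereal r < ereal (r + 1)" by simp
    with N show "\<exists>N. \<forall>n\<ge>N. ereal r < rat_pval p (X n)"
      by (meson less_le_trans)
  qed (meson less_imp_le)
  finally show ?thesis .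
qed

lemma padic_Cauchy_const [simp]: "padic_Cauchy p (\<lambda>_. q)"
  by (simp add: padic_Cauchy_def)

lemma padic_Cauchy_add:
  assumes "prime p" "padic_Cauchy p X" "padic_Cauchy p Y"
  shows "padic_Cauchy p (\<lambda>n. X n + Y n)"
  unfolding padic_Cauchy_def
proof
  fix r :: real
  obtain M where M: "\<And>i j. i \<ge> M \<Longrightarrow> j \<ge> M \<Longrightarrow> ereal r \<le> rat_pval p (X i - X j)"
    using assms(2) unfolding padic_Cauchy_def by meson
  obtain N where N: "\<And>i j. i \<ge> N \<Longrightarrow> j \<ge> N \<Longrightarrow> ereal r \<le> rat_pval p (Y i - Y j)"
    using assms(3) unfolding padic_Cauchy_def by meson
  have "ereal r \<le> rat_pval p (X i + Y i - (X j + Y j))" if "i \<ge> max M N" "j \<ge> max M N" for i j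
    using rat_pval_add_ge[OF assms(1) M[of i j] N[of i j]] that by (simp add: algebra_simps)
  then show "\<exists>N. \<forall>i\<ge>N. \<forall>j\<ge>N. ereal r \<le> rat_pval p (X i + Y i - (X j + Y j))" by blast
qed

lemma padic_Cauchy_minus: "padic_Cauchy p X \<Longrightarrow> padic_Cauchy p (\<lambda>n. - X n)"
  unfolding padic_Cauchy_def by (simp add: rat_pval_diff_commute)

lemma padic_Cauchy_cases:
  assumes p: "prime p" and X: "padic_Cauchy p X"
  obtains (null) "X \<in> padic_null p"
    | (nonnull) v N where "\<And>n. n \<ge> N \<Longrightarrow> rat_pval p (X n) = ereal v"
proof (cases "X \<in> padic_null p")
  case False
  then obtain r :: real where r: "\<And>N. \<exists>n\<ge>N. rat_pval p (X n) < ereal r"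
    unfolding padic_null_iff by (meson not_le)
  obtain N where N: "\<And>i j. i \<ge> N \<Longrightarrow> j \<ge> N \<Longrightarrow> ereal r \<le> rat_pval p (X i - X j)"
    using X unfolding padic_Cauchy_def by meson
  obtain m where m: "m \<ge> N" "rat_pval p (X m) < ereal r" using r by blast
  have "rat_pval p (X n) = rat_pval p (X m)" if "n \<ge> N" for n
  proof -
    have d: "rat_pval p (X m) < rat_pval p (X n - X m)" "rat_pval p (X m) < rat_pval p (X m - X n)"
      using N[OF that m(1)] N[OF m(1) that] m(2) by order+
    show ?thesis
      using rat_pval_add[OF p, of "X n - X m" "X m"] rat_pval_add[OF p, of "X m - X n" "X n"] d
      by (auto simp: min_def split: if_splits)
  qed
  moreover have "rat_pval p (X m) = ereal (real_of_ereal (rat_pval p (X m)))"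
    using m(2) by (auto simp: rat_pval_def)
  ultimately show ?thesis using nonnull by metis
qed (use null in blast)

lemma padic_Cauchy_bounded_below:
  assumes p: "prime p" and X: "padic_Cauchy p X"
  obtains b :: real and N where "\<And>n. n \<ge> N \<Longrightarrow> ereal b \<le> rat_pval p (X n)"
  using p X
proof (cases rule: padic_Cauchy_cases)
  case null
  then obtain N where "\<forall>n\<ge>N. ereal 0 \<le> rat_pval p (X n)"
    unfolding padic_null_iff by blast
  then show ?thesis using that[of N 0] by blast
next
  case (nonnull v N)
  then show ?thesis using that[of N v] by simp
qed

lemma padic_null_mult:
  assumes p: "prime p" and X: "padic_Cauchy p X" and Y: "Y \<in> padic_null p"
  shows "(\<lambda>n. X n * Y n) \<in> padic_null p"
  unfolding padic_null_iff
proof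
  fix r :: real
  obtain b M where b: "\<And>n. n \<ge> M \<Longrightarrow> ereal b \<le> rat_pval p (X n)"
    using padic_Cauchy_bounded_below[OF p X] by metis
  obtain N where N: "\<And>n. n \<ge> N \<Longrightarrow> ereal (r - b) \<le> rat_pval p (Y n)"
    using Y unfolding padic_null_iff by meson
  have "ereal r \<le> rat_pval p (X n * Y n)" if "n \<ge> max M N" for n
    using add_mono[OF b[of n] N[of n]] that by (simp add: rat_pval_mult[OF p])
  then show "\<exists>N. \<forall>n\<ge>N. ereal r \<le> rat_pval p (X n * Y n)" by blast
qed

lemma padic_Cauchy_mult:
  assumes p: "prime p" and X: "padic_Cauchy p X" and Y: "padic_Cauchy p Y"
  shows "padic_Cauchy p (\<lambda>n. X n * Y n)"
  unfolding padic_Cauchy_def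
proof
  fix r :: real
  obtain b M where b: "\<And>n. n \<ge> M \<Longrightarrow> ereal b \<le> rat_pval p (X n)"
    using padic_Cauchy_bounded_below[OF p X] by metis
  obtain c M' where c: "\<And>n. n \<ge> M' \<Longrightarrow> ereal c \<le> rat_pval p (Y n)"
    using padic_Cauchy_bounded_below[OF p Y] by metis
  obtain N where N: "\<And>i j. i \<ge> N \<Longrightarrow> j \<ge> N \<Longrightarrow> ereal (r - c) \<le> rat_pval p (X i - X j)"
    using X unfolding padic_Cauchy_def by meson
  obtain N' where N': "\<And>i j. i \<ge> N' \<Longrightarrow> j \<ge> N' \<Longrightarrow> ereal (r - b) \<le> rat_pval p (Y i - Y j)"
    using Y unfolding padic_Cauchy_def by meson
  let ?K = "max (max M M') (max N N')"
  have "ereal r \<le> rat_pval p (X i * Y i - X j * Y j)" if "i \<ge> ?K" "j \<ge> ?K" for i j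
  proof -
    have "ereal r \<le> rat_pval p ((X i - X j) * Y i)"
      using add_mono[OF N[of i j] c[of i]] that by (simp add: rat_pval_mult[OF p])
    moreover have "ereal r \<le> rat_pval p (X j * (Y i - Y j))"
      using add_mono[OF b[of j] N'[of i j]] that by (simp add: rat_pval_mult[OF p])
    ultimately have "ereal r \<le> rat_pval p ((X i - X j) * Y i + X j * (Y i - Y j))"
      by (rule rat_pval_add_ge[OF p])
    then show ?thesis by (simp add: algebra_simps)
  qed
  then show "\<exists>N. \<forall>i\<ge>N. \<forall>j\<ge>N. ereal r \<le> rat_pval p (X i * Y i - X j * Y j)" by blast
qed

lemma padic_Cauchy_ring_simps [simp]:
  "carrier (padic_Cauchy_ring p) = {X. padic_Cauchy p X}"
  "X \<otimes>\<^bsub>padic_Cauchy_ring p\<^esub> Y = (\<lambda>n. X n * Y n)"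
  "X \<oplus>\<^bsub>padic_Cauchy_ring p\<^esub> Y = (\<lambda>n. X n + Y n)"
  "\<one>\<^bsub>padic_Cauchy_ring p\<^esub> = (\<lambda>_. 1)"
  "\<zero>\<^bsub>padic_Cauchy_ring p\<^esub> = (\<lambda>_. 0)"
  by (simp_all add: padic_Cauchy_ring_def)

lemma padic_Cauchy_ring_cring:
  assumes "prime p"
  shows "cring (padic_Cauchy_ring p)"
proof (rule cringI)
  show "abelian_group (padic_Cauchy_ring p)"
  proof (rule abelian_groupI)
    fix X assume "X \<in> carrier (padic_Cauchy_ring p)"
    then show "\<exists>Y\<in>carrier (padic_Cauchy_ring p). Y \<oplus>\<^bsub>padic_Cauchy_ring p\<^esub> X = \<zero>\<^bsub>padic_Cauchy_ring p\<^esub>"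
      by (intro bexI[of _ "\<lambda>n. - X n"]) (auto simp: padic_Cauchy_minus)
  qed (auto simp: padic_Cauchy_add[OF assms] algebra_simps)
  show "comm_monoid (padic_Cauchy_ring p)"
    by (rule comm_monoidI) (auto simp: padic_Cauchy_mult[OF assms] algebra_simps)
qed (auto simp: algebra_simps)

lemma padic_null_Cauchy:
  assumes "prime p" "X \<in> padic_null p"
  shows "padic_Cauchy p X"
  unfolding padic_Cauchy_def
proof
  fix r :: real
  obtain N where N: "\<And>n. n \<ge> N \<Longrightarrow> ereal r \<le> rat_pval p (X n)"
    using assms(2) unfolding padic_null_iff by meson
  have "ereal r \<le> rat_pval p (X i - X j)" if "i \<ge> N" "j \<ge> N" for i j
    using rat_pval_add_ge[OF assms(1) N[of i], of "- X j"] N[of j] that by simp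
  then show "\<exists>N. \<forall>i\<ge>N. \<forall>j\<ge>N. ereal r \<le> rat_pval p (X i - X j)" by blast
qed

lemma padic_null_add:
  assumes "prime p" "X \<in> padic_null p" "Y \<in> padic_null p"
  shows "(\<lambda>n. X n + Y n) \<in> padic_null p"
  unfolding padic_null_iff
proof
  fix r :: real
  obtain M where M: "\<And>n. n \<ge> M \<Longrightarrow> ereal r \<le> rat_pval p (X n)"
    using assms(2) unfolding padic_null_iff by meson
  obtain N where N: "\<And>n. n \<ge> N \<Longrightarrow> ereal r \<le> rat_pval p (Y n)"
    using assms(3) unfolding padic_null_iff by meson
  have "ereal r \<le> rat_pval p (X n + Y n)" if "n \<ge> max M N" for n
    using rat_pval_add_ge[OF assms(1) M[of n] N[of n]] that by simp
  then show "\<exists>N. \<forall>n\<ge>N. ereal r \<le> rat_pval p (X n + Y n)" by blast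
qed

lemma padic_null_ideal:
  assumes p: "prime p"
  shows "ideal (padic_null p) (padic_Cauchy_ring p)"
proof -
  interpret cring "padic_Cauchy_ring p" by (rule padic_Cauchy_ring_cring[OF p])
  have inv: "\<ominus>\<^bsub>padic_Cauchy_ring p\<^esub> X = (\<lambda>n. - X n)" if "padic_Cauchy p X" for X
    by (rule sum_zero_eq_neg[symmetric]) (use that in \<open>auto simp: padic_Cauchy_minus\<close>)
  show ?thesis
  proof (rule idealI)
    show "ring (padic_Cauchy_ring p)" by (rule ring_axioms)
    show "subgroup (padic_null p) (add_monoid (padic_Cauchy_ring p))"
    proof (rule add.subgroupI)
      show "padic_null p \<noteq> {}" by (auto simp: padic_null_def intro!: exI[of _ "\<lambda>_. 0"])
      show "\<ominus>\<^bsub>padic_Cauchy_ring p\<^esub> X \<in> padic_null p" if "X \<in> padic_null p" for X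
        using that padic_null_Cauchy[OF p that] by (simp add: inv padic_null_iff)
    qed (auto simp: padic_null_Cauchy[OF p] padic_null_add[OF p])
    fix X Y assume "X \<in> padic_null p" "Y \<in> carrier (padic_Cauchy_ring p)"
    then show "Y \<otimes>\<^bsub>padic_Cauchy_ring p\<^esub> X \<in> padic_null p"
      and "X \<otimes>\<^bsub>padic_Cauchy_ring p\<^esub> Y \<in> padic_null p"
      using padic_null_mult[OF p, of Y X] by (auto simp: mult.commute)
  qed
qed

lemma Qp_cring: "prime p \<Longrightarrow> cring (Qp p)"
  unfolding Qp_def by (rule ideal.quotient_is_cring[OF padic_null_ideal padic_Cauchy_ring_cring])

lemma Qp_carrier:
  "carrier (Qp p) = (\<lambda>X. padic_null p +>\<^bsub>padic_Cauchy_ring p\<^esub> X) ` {X. padic_Cauchy p X}"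
  by (auto simp: Qp_def FactRing_def A_RCOSETS_def')

lemma padic_of_rat_closed [simp]: "padic_of_rat p q \<in> carrier (Qp p)"
  by (auto simp: padic_of_rat_def Qp_carrier)

lemma Qp_class_eq:
  assumes p: "prime p" and x: "x \<in> carrier (Qp p)" and X: "X \<in> x"
  shows "padic_Cauchy p X" and "x = padic_null p +>\<^bsub>padic_Cauchy_ring p\<^esub> X"
proof -
  interpret cring "padic_Cauchy_ring p" by (rule padic_Cauchy_ring_cring[OF p])
  interpret ideal "padic_null p" "padic_Cauchy_ring p" by (rule padic_null_ideal[OF p])
  obtain Y where Y: "padic_Cauchy p Y" "x = padic_null p +>\<^bsub>padic_Cauchy_ring p\<^esub> Y"
    using x by (auto simp: Qp_carrier)
  then show "x = padic_null p +>\<^bsub>padic_Cauchy_ring p\<^esub> X"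
    using X a_repr_independence' by simp
  show "padic_Cauchy p X"
    using X Y padic_null_Cauchy[OF p] padic_Cauchy_add[OF p] by (auto simp: a_r_coset_def')
qed

lemma Qp_nonempty:
  assumes p: "prime p" and x: "x \<in> carrier (Qp p)"
  obtains X where "X \<in> x"
proof -
  interpret ideal "padic_null p" "padic_Cauchy_ring p" by (rule padic_null_ideal[OF p])
  obtain Y where Y: "padic_Cauchy p Y" "x = padic_null p +>\<^bsub>padic_Cauchy_ring p\<^esub> Y"
    using x by (auto simp: Qp_carrier)
  then show ?thesis using a_rcos_self[of Y] that by simp
qed

lemma padic_Cauchy_inverse:
  assumes p: "prime p" and X: "padic_Cauchy p X" and v: "\<And>n. n \<ge> N \<Longrightarrow> rat_pval p (X n) = ereal v"
  shows "padic_Cauchy p (\<lambda>n. inverse (X n))"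
  unfolding padic_Cauchy_def
proof
  fix r :: real
  obtain M where M: "\<And>i j. i \<ge> M \<Longrightarrow> j \<ge> M \<Longrightarrow> ereal (r + 2 * v) \<le> rat_pval p (X i - X j)"
    using X unfolding padic_Cauchy_def by meson
  have "ereal r \<le> rat_pval p (inverse (X i) - inverse (X j))" if "i \<ge> max M N" "j \<ge> max M N" for i j
  proof -
    have nz: "X i \<noteq> 0" "X j \<noteq> 0" using v[of i] v[of j] that by auto
    then have "X j - X i = (inverse (X i) - inverse (X j)) * (X i * X j)"
      by (simp add: field_simps)
    then have "rat_pval p (X j - X i) = rat_pval p (inverse (X i) - inverse (X j)) + ereal (2 * v)"
      using v[of i] v[of j] that by (simp add: rat_pval_mult[OF p])
    moreover have "ereal (r + 2 * v) \<le> rat_pval p (X j - X i)" using M that by simp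
    ultimately show ?thesis
      by (cases "rat_pval p (inverse (X i) - inverse (X j))") auto
  qed
  then show "\<exists>N. \<forall>i\<ge>N. \<forall>j\<ge>N. ereal r \<le> rat_pval p (inverse (X i) - inverse (X j))" by blast
qed

lemma Qp_field:
  assumes p: "prime p"
  shows "field (Qp p)"
proof (rule cring.cring_fieldI2[OF Qp_cring[OF p]])
  interpret cring "padic_Cauchy_ring p" by (rule padic_Cauchy_ring_cring[OF p])
  interpret ideal "padic_null p" "padic_Cauchy_ring p" by (rule padic_null_ideal[OF p])
  have mult: "(padic_null p +>\<^bsub>padic_Cauchy_ring p\<^esub> X) \<otimes>\<^bsub>Qp p\<^esub> (padic_null p +>\<^bsub>padic_Cauchy_ring p\<^esub> Y)
      = padic_null p +>\<^bsub>padic_Cauchy_ring p\<^esub> (\<lambda>n. X n * Y n)"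
    if "padic_Cauchy p X" "padic_Cauchy p Y" for X Y
    using rcoset_mult_add[of X Y] that by (simp add: Qp_def FactRing_def)
  have one: "\<one>\<^bsub>Qp p\<^esub> = padic_null p +>\<^bsub>padic_Cauchy_ring p\<^esub> (\<lambda>_. 1)"
    and zero: "\<zero>\<^bsub>Qp p\<^esub> = padic_null p"
    by (simp_all add: Qp_def FactRing_def)
  have "(\<lambda>_. 1) \<in> padic_null p +>\<^bsub>padic_Cauchy_ring p\<^esub> (\<lambda>_. 1)"
    by (rule a_rcos_self) simp
  moreover have "(\<lambda>_. 1) \<notin> padic_null p"
  proof
    assume "(\<lambda>_. 1) \<in> padic_null p"
    then have "ereal 1 \<le> rat_pval p 1" unfolding padic_null_iff by blast
    then show False using rat_pval_of_int[OF p, of 1] by simp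
  qed
  ultimately show "\<zero>\<^bsub>Qp p\<^esub> \<noteq> \<one>\<^bsub>Qp p\<^esub>" unfolding one zero by blast
  fix x assume x: "x \<in> carrier (Qp p)" "x \<noteq> \<zero>\<^bsub>Qp p\<^esub>"
  then obtain X where X: "padic_Cauchy p X" "x = padic_null p +>\<^bsub>padic_Cauchy_ring p\<^esub> X"
    by (auto simp: Qp_carrier)
  show "\<exists>y\<in>carrier (Qp p). x \<otimes>\<^bsub>Qp p\<^esub> y = \<one>\<^bsub>Qp p\<^esub>"
    using p X(1)
  proof (cases rule: padic_Cauchy_cases)
    case null
    then show ?thesis using x X zero a_coset_join2[of X] a_subgroup by auto
  next
    case (nonnull v N)
    let ?Y = "\<lambda>n. inverse (X n)"
    have Y: "padic_Cauchy p ?Y" by (rule padic_Cauchy_inverse[OF p X(1) nonnull])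
    have "X n * ?Y n - 1 = 0" if "n \<ge> N" for n
    proof -
      have "X n \<noteq> 0" using nonnull[OF that] by auto
      then show ?thesis by simp
    qed
    then have "(\<lambda>n. X n * ?Y n - 1) \<in> padic_null p"
      unfolding padic_null_iff by (intro allI exI[of _ N]) simp
    then have "(\<lambda>n. X n * ?Y n) \<in> padic_null p +>\<^bsub>padic_Cauchy_ring p\<^esub> (\<lambda>_. 1)"
      by (force simp: a_r_coset_def')
    then have "padic_null p +>\<^bsub>padic_Cauchy_ring p\<^esub> (\<lambda>n. X n * ?Y n) = \<one>\<^bsub>Qp p\<^esub>"
      unfolding one using a_repr_independence'[of _ "\<lambda>_. 1"] by simp
    then show ?thesis using mult[OF X(1) Y] X(2) Y by (auto simp: Qp_carrier)
  qed
qed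

lemma padic_Cauchy_pval_convergent:
  assumes p: "prime p" and X: "padic_Cauchy p X"
  obtains v where "(\<lambda>n. rat_pval p (X n)) \<longlonglongrightarrow> v"
  using p X
proof (cases rule: padic_Cauchy_cases)
  case null
  then show ?thesis using that by (auto simp: padic_null_def)
next
  case (nonnull v N)
  then show ?thesis
    by (intro that[of "ereal v"] tendsto_eventually)
      (auto simp: eventually_sequentially)
qed

lemma padic_val_eqI:
  assumes p: "prime p" and x: "x \<in> carrier (Qp p)" and X: "X \<in> x"
    and v: "(\<lambda>n. rat_pval p (X n)) \<longlonglongrightarrow> v"
  shows "padic_val p x = v"
  unfolding padic_val_def
proof (rule the_equality)
  show "\<forall>Y\<in>x. (\<lambda>n. rat_pval p (Y n)) \<longlonglongrightarrow> v"
  proof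
    fix Y assume "Y \<in> x"
    then obtain H where H: "H \<in> padic_null p" and Y: "Y = (\<lambda>n. H n + X n)"
      using Qp_class_eq[OF p x X] by (auto simp: a_r_coset_def')
    show "(\<lambda>n. rat_pval p (Y n)) \<longlonglongrightarrow> v"
      using p Qp_class_eq(1)[OF p x X]
    proof (cases rule: padic_Cauchy_cases)
      case null
      then have "v = \<infinity>" using v LIMSEQ_unique by (auto simp: padic_null_def)
      then show ?thesis using padic_null_add[OF p H null] by (simp add: Y padic_null_def)
    next
      case (nonnull w N)
      obtain M where M: "\<And>n. n \<ge> M \<Longrightarrow> ereal (w + 1) \<le> rat_pval p (H n)"
        using H unfolding padic_null_iff by meson
      have "rat_pval p (Y n) = rat_pval p (X n)" if "n \<ge> max M N" for n
      proof -
        have "ereal w < ereal (w + 1)" by simp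
        also have "\<dots> \<le> rat_pval p (H n)" using M that by simp
        finally have H': "ereal w < rat_pval p (H n)" .
        have X': "rat_pval p (X n) = ereal w" using nonnull that by simp
        have "min (rat_pval p (H n)) (ereal w) \<le> rat_pval p (Y n)"
          using rat_pval_add[OF p, of "H n" "X n"] unfolding X' by (simp add: Y)
        moreover have "min (rat_pval p (Y n)) (rat_pval p (H n)) \<le> ereal w"
          using rat_pval_add[OF p, of "Y n" "- H n"] X' by (simp add: Y)
        ultimately show ?thesis
          using H' unfolding X' by (auto simp: min_def split: if_splits)
      qed
      then have "\<forall>\<^sub>F n in sequentially. rat_pval p (X n) = rat_pval p (Y n)"
        unfolding eventually_sequentially by (intro exI[of _ "max M N"]) simp
      then show ?thesis by (rule Lim_transform_eventually[OF v])
    qed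
  qed
next
  fix w assume "\<forall>Y\<in>x. (\<lambda>n. rat_pval p (Y n)) \<longlonglongrightarrow> w"
  then show "w = v" using X v by (meson LIMSEQ_unique)
qed

lemma padic_val_of_rat:
  assumes p: "prime p"
  shows "padic_val p (padic_of_rat p q) = rat_pval p q"
proof -
  interpret ideal "padic_null p" "padic_Cauchy_ring p" by (rule padic_null_ideal[OF p])
  show ?thesis
    by (rule padic_val_eqI[OF p padic_of_rat_closed, of "\<lambda>_. q"])
      (auto simp: padic_of_rat_def intro!: a_rcos_self)
qed

section \<open>Independent sets of Cayley graphs\<close>

definition cayley_edges :: "('a, 'b) monoid_scheme \<Rightarrow> 'a set \<Rightarrow> 'a set set" where
  "cayley_edges G S = {{g, g \<otimes>\<^bsub>G\<^esub> s} | g s. g \<in> carrier G \<and> s \<in> S}"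

definition independent_sets :: "'v set \<Rightarrow> 'v set set \<Rightarrow> 'v set set" where
  "independent_sets V E = {A. A \<subseteq> V \<and> (\<forall>e\<in>E. \<not> e \<subseteq> A)}"

definition torus_group :: "nat \<Rightarrow> nat \<Rightarrow> (nat \<Rightarrow> int) monoid" where
  "torus_group d n = product_group {1..d} (\<lambda>_. integer_mod_group n)"

text \<open>The reduction modulo \<open>n\<close> matters only for \<open>n = 1\<close>, where \<open>std_vec\<close> is the neutral element.\<close>

definition std_vec :: "nat \<Rightarrow> nat \<Rightarrow> nat \<Rightarrow> nat \<Rightarrow> int" where
  "std_vec d n i = (\<lambda>j\<in>{1..d}. if j = i then 1 mod int n else 0)"

definition torus_gens :: "nat \<Rightarrow> nat \<Rightarrow> (nat \<Rightarrow> int) set" where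
  "torus_gens d n =
     (std_vec d n ` {1..d} \<union> (\<lambda>i. inv\<^bsub>torus_group d n\<^esub> std_vec d n i) ` {1..d})
       - {\<one>\<^bsub>torus_group d n\<^esub>}"

definition torus_indep_count :: "nat \<Rightarrow> nat \<Rightarrow> nat" where
  "torus_indep_count d n =
     card (independent_sets (carrier (torus_group d n))
       (cayley_edges (torus_group d n) (torus_gens d n)))"

definition padic_indep_count :: "nat \<Rightarrow> nat \<Rightarrow> nat \<Rightarrow> (nat \<Rightarrow> rat) set" where
  "padic_indep_count p d n = padic_of_rat p (of_nat (torus_indep_count d n))"

definition Tame :: "nat \<Rightarrow> nat set" where
  "Tame d = {p. prime p \<and> (\<forall>k\<ge>1.
     padic_val p (padic_indep_count p d (p ^ k) \<ominus>\<^bsub>Qp p\<^esub> \<one>\<^bsub>Qp p\<^esub>)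
       = padic_val p (padic_indep_count p d p \<ominus>\<^bsub>Qp p\<^esub> \<one>\<^bsub>Qp p\<^esub>))}"

end

theory Submission
  imports Defs "HOL-Number_Theory.Cong"
begin

text \<open>
  Translation by \<open>e\<^sub>i\<close> permutes the independent sets of \<open>T\<^sub>d(p\<^sup>k\<^sup>+\<^sup>1)\<close>, and its \<open>p\<^sup>k\<^sup>+\<^sup>1\<close>-th
  power is the identity. An orbit of length less than \<open>p\<^sup>k\<^sup>+\<^sup>1\<close> consists of sets that are invariant
  under \<open>p\<^sup>k e\<^sub>i\<close>, so modulo \<open>p\<^sup>k\<^sup>+\<^sup>1\<close> only these count; restricting to them for one \<open>i\<close> after the
  other leaves the independent sets that are invariant under \<open>p\<^sup>k e\<^sub>1, \<dots>, p\<^sup>k e\<^sub>d\<close>. For \<open>k \<ge> 1\<close> these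
  are the preimages of the independent sets of \<open>T\<^sub>d(p\<^sup>k)\<close>, and for \<open>k = 0\<close> only the empty set
  remains. Hence \<open>a\<^sub>d(p\<^sup>k\<^sup>+\<^sup>1) \<equiv> a\<^sub>d(p\<^sup>k)\<close> modulo \<open>p\<^sup>k\<^sup>+\<^sup>1\<close> and \<open>a\<^sub>d(p) \<equiv> 1\<close> modulo \<open>p\<close>, which makes
  the sequence Cauchy.
\<close>

section \<open>Counting independent sets modulo prime powers\<close>

text \<open>Orbit lengths divide \<open>p ^ Suc m\<close>. A point moved by
  \<open>f ^^ (p ^ m)\<close> has an orbit of full length \<open>p ^ Suc m\<close>, and such orbits
  partition the set \<open>Y\<close> of moved points, so \<open>card Y\<close> vanishes modulo
  \<open>p ^ Suc m\<close>.\<close>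

lemma card_cong_card_funpow_fixed:
  fixes f :: "'a \<Rightarrow> 'a" and p m :: nat
  assumes p: "prime p" and fin: "finite X" and maps: "\<And>x. x \<in> X \<Longrightarrow> f x \<in> X"
    and id: "\<And>x. x \<in> X \<Longrightarrow> (f ^^ (p ^ Suc m)) x = x"
  shows "[card X = card {x \<in> X. (f ^^ (p ^ m)) x = x}] (mod p ^ Suc m)"
proof -
  define n where "n = p ^ Suc m"
  define Y where "Y = {x \<in> X. (f ^^ (p ^ m)) x \<noteq> x}"
  define orb where "orb x = (\<lambda>i. (f ^^ i) x) ` {..<n}" for x
  have n: "n > 0" using p by (simp add: n_def prime_gt_0_nat)
  have comp: "(f ^^ i) ((f ^^ j) x) = (f ^^ (i + j)) x" for i j x by (simp add: funpow_add)
  have swap: "(f ^^ i) ((f ^^ j) x) = (f ^^ j) ((f ^^ i) x)" for i j x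
    unfolding comp by (simp add: add.commute)
  have X: "(f ^^ i) x \<in> X" if "x \<in> X" for i x using that maps by (induction i) auto
  have period: "(f ^^ n) x = x" if "x \<in> X" for x using id[OF that] by (simp only: n_def)
  have orbI: "(f ^^ i) x \<in> orb x" if "x \<in> X" for i x
    unfolding orb_def using n by (intro image_eqI[of _ _ "i mod n"])
      (simp_all add: funpow_mod_eq[OF period[OF that]])
  \<comment> \<open>Inverses come from the period: \<open>f ^^ (n - i)\<close> undoes
    \<open>f ^^ i\<close> on \<open>X\<close>.\<close>
  have return: "(f ^^ (n - i)) ((f ^^ i) x) = x" if "x \<in> X" "i < n" for i x
    using that period by (simp add: comp)
  have orbY: "orb x \<subseteq> Y" if "x \<in> Y" for x
  proof
    fix y assume "y \<in> orb x"
    then obtain i where i: "i < n" "y = (f ^^ i) x" by (auto simp: orb_def)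
    have x: "x \<in> X" "(f ^^ (p ^ m)) x \<noteq> x" using that by (auto simp: Y_def)
    have "(f ^^ (p ^ m)) y \<noteq> y"
    proof
      assume "(f ^^ (p ^ m)) y = y"
      then have "(f ^^ (n - i)) ((f ^^ (p ^ m)) y) = x" using return x i by simp
      then show False using x return[OF x(1) i(1)] i(2) by (simp add: swap[of "n - i"])
    qed
    then show "y \<in> Y" using X[OF x(1)] i by (simp add: Y_def)
  qed
  have orb_sub: "orb y \<subseteq> orb x" if "x \<in> X" "y \<in> orb x" for x y
    using that orbI[OF that(1)] by (auto simp: orb_def[of y] comp) (auto simp: orb_def comp)
  have orb_eq: "orb y = orb x" if "x \<in> X" "y \<in> orb x" for x y
  proof (rule antisym[OF orb_sub[OF that]])
    from that(2) obtain i where i: "i < n" "y = (f ^^ i) x" by (auto simp: orb_def)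
    have "x \<in> orb y" using orbI[of y "n - i"] X[OF that(1)] return[OF that(1) i(1)] i(2) by simp
    then show "orb x \<subseteq> orb y" using orb_sub[of y x] X[OF that(1)] i(2) by simp
  qed
  have card_orb: "card (orb x) = n" if "x \<in> Y" for x
  proof -
    have x: "x \<in> X" "(f ^^ (p ^ m)) x \<noteq> x" using that by (auto simp: Y_def)
    have no_early: False if r0: "0 < r" "r < n" and r: "(f ^^ r) x = x" for r
    proof -
      have mult: "(f ^^ (r * i)) x = x" for i
        using funpow_mod_eq[OF r, of "r * i"] by simp
      have mult': "(f ^^ (n * i)) x = x" for i
        using funpow_mod_eq[OF period[OF x(1)], of "n * i"] by simp
      \<comment> \<open>By Bezout the gcd of two return times is itself a return time. Here it is a
        proper divisor of \<open>p ^ Suc m\<close>, hence divides \<open>p ^ m\<close>, although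
        \<open>f ^^ (p ^ m)\<close> moves \<open>x\<close>.\<close>
      obtain u v where uv: "r * u = n * v + gcd r n" using bezout_nat[of r n] r0 by auto
      have "(f ^^ gcd r n) x = (f ^^ gcd r n) ((f ^^ (n * v)) x)" by (simp add: mult')
      also have "\<dots> = x" using mult[of u] by (simp add: comp uv add.commute)
      finally have g: "(f ^^ gcd r n) x = x" .
      obtain k where k: "k \<le> Suc m" "gcd r n = p ^ k"
        using divides_primepow_nat[OF p, of "gcd r n" "Suc m"] by (auto simp: n_def)
      have "gcd r n \<noteq> n" using r0 by (metis gcd_le1_nat less_not_refl3 not_less)
      then have "k \<noteq> Suc m" using k by (auto simp: n_def)
      then have "p ^ k dvd p ^ m" using k by (intro le_imp_power_dvd) simp
      then have "p ^ m mod p ^ k = 0" by simp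
      then show False using funpow_mod_eq[OF g, of "p ^ m"] x(2) k(2) by simp
    qed
    have "inj_on (\<lambda>i. (f ^^ i) x) {..<n}"
    proof (rule linorder_inj_onI)
      fix i j assume ij: "i < j" "i \<in> {..<n}" "j \<in> {..<n}"
      show "(f ^^ i) x \<noteq> (f ^^ j) x"
      proof
        assume "(f ^^ i) x = (f ^^ j) x"
        \<comment> \<open>Undoing \<open>f ^^ i\<close> on both sides of a collision leaves the
          return time \<open>j - i\<close>, which is positive and below \<open>n\<close>.\<close>
        then have "(f ^^ (n - i)) ((f ^^ j) x) = x" using return[OF x(1), of i] ij by simp
        then have "(f ^^ (n + (j - i))) x = x" using ij by (simp add: comp)
        then have "(f ^^ (j - i)) x = x"
          using period[OF x(1)] by (simp add: funpow_add swap[of n])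
        moreover have "j - i < n" using ij by auto
        ultimately show False using no_early[of "j - i"] ij by simp
      qed
    qed auto
    then show ?thesis by (simp add: orb_def card_image)
  qed
  have YX: "Y \<subseteq> X" by (auto simp: Y_def)
  have finY: "finite Y" using fin YX by (rule rev_finite_subset)
  have self: "x \<in> orb x" if "x \<in> X" for x using orbI[OF that, of 0] by simp
  have UY: "\<Union> (orb ` Y) = Y" using orbY self YX by blast
  have "n * card (orb ` Y) = card (\<Union> (orb ` Y))"
  proof (rule card_partition)
    show "finite (orb ` Y)" "finite (\<Union> (orb ` Y))" using finY UY by simp_all
    show "card c = n" if "c \<in> orb ` Y" for c using that card_orb by auto
    show "c \<inter> c' = {}" if "c \<in> orb ` Y" "c' \<in> orb ` Y" "c \<noteq> c'" for c c'
      using that orb_eq YX by blast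
  qed
  then have "n dvd card Y" using UY by (metis dvd_triv_left)
  moreover have "card X = card {x \<in> X. (f ^^ (p ^ m)) x = x} + card Y"
    using fin by (subst card_Un_disjoint[symmetric]) (auto simp: Y_def intro: arg_cong[of _ _ card])
  ultimately show ?thesis by (simp add: n_def cong_def mod_add_eq[symmetric] mod_eq_0_iff_dvd[THEN iffD2])
qed

section \<open>Families of subsets closed under translations\<close>

lemma (in group) l_coset_funpow:
  assumes "t \<in> carrier G" "A \<subseteq> carrier G"
  shows "((\<lambda>A. t <# A) ^^ n) A = t [^] n <# A"
proof (induction n)
  case 0
  then show ?case using assms by (simp add: lcos_mult_one)
next
  case (Suc n)
  then show ?case using assms
    by (simp only: nat_pow_Suc2) (simp add: lcos_m_assoc)
qed

text \<open>Induction on \<open>T\<close>, with the orbit congruence applied once for each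
  \<open>t\<close>. By commutativity, translation by \<open>t\<close> preserves the subfamily cut
  out by the conditions for the earlier elements, so it is a self-map of what remains.\<close>

lemma (in comm_group) card_cong_card_l_coset_fixed:
  assumes p: "prime (p::nat)" and T: "finite T" "T \<subseteq> carrier G"
    and ord: "\<And>t. t \<in> T \<Longrightarrow> t [^] (p ^ Suc m) = \<one>"
    and F: "finite F" "\<And>A. A \<in> F \<Longrightarrow> A \<subseteq> carrier G"
    and closed: "\<And>t A. t \<in> T \<Longrightarrow> A \<in> F \<Longrightarrow> t <# A \<in> F"
  shows "[card F = card {A \<in> F. \<forall>t\<in>T. t [^] (p ^ m) <# A = A}] (mod p ^ Suc m)"
  using T ord closed
proof (induction T)
  case empty
  then show ?case by simp
next
  case (insert t T)
  define F' where "F' = {A \<in> F. \<forall>t\<in>T. t [^] (p ^ m) <# A = A}"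
  have t: "t \<in> carrier G" using insert by simp
  have IH: "[card F = card F'] (mod p ^ Suc m)" unfolding F'_def using insert by auto
  have "[card F' = card {A \<in> F'. ((\<lambda>A. t <# A) ^^ (p ^ m)) A = A}] (mod p ^ Suc m)"
  proof (rule card_cong_card_funpow_fixed[OF p])
    show "finite F'" using F by (simp add: F'_def)
    show "t <# A \<in> F'" if A: "A \<in> F'" for A
    proof -
      have "s [^] (p ^ m) <# (t <# A) = t <# A" if s: "s \<in> T" for s
      proof -
        have s': "s \<in> carrier G" using insert s by auto
        have AG: "A \<subseteq> carrier G" using A F by (auto simp: F'_def)
        have "s [^] (p ^ m) <# (t <# A) = t <# (s [^] (p ^ m) <# A)"
          using s' t AG by (simp add: lcos_m_assoc m_comm)
        then show ?thesis using A s by (simp add: F'_def)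
      qed
      then show ?thesis using A insert.prems by (auto simp: F'_def)
    qed
    show "((\<lambda>A. t <# A) ^^ (p ^ Suc m)) A = A" if "A \<in> F'" for A
    proof -
      have A: "A \<subseteq> carrier G" using that F by (simp add: F'_def)
      have "t [^] (p ^ Suc m) = \<one>" using insert.prems by blast
      then show ?thesis
        by (simp only: l_coset_funpow[OF t A] lcos_mult_one[OF A])
    qed
  qed
  also have "{A \<in> F'. ((\<lambda>A. t <# A) ^^ (p ^ m)) A = A}
      = {A \<in> F. \<forall>t\<in>insert t T. t [^] (p ^ m) <# A = A}"
    using F t by (auto simp: F'_def l_coset_funpow)
  finally show ?case using IH cong_trans by blast
qed

section \<open>Independent sets of Cayley graphs under translations and homomorphisms\<close>

text \<open>Edges arise by right multiplication with a generator, so left translation is a graph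
  automorphism.\<close>

lemma (in group) l_coset_independent_sets:
  assumes S: "S \<subseteq> carrier G" and t: "t \<in> carrier G"
    and A: "A \<in> independent_sets (carrier G) (cayley_edges G S)"
  shows "t <# A \<in> independent_sets (carrier G) (cayley_edges G S)"
proof -
  have AG: "A \<subseteq> carrier G" using A by (simp add: independent_sets_def)
  have False if g: "g \<in> carrier G" "s \<in> S" "{g, g \<otimes> s} \<subseteq> t <# A" for g s
  proof -
    obtain a b where ab: "a \<in> A" "b \<in> A" "g = t \<otimes> a" "g \<otimes> s = t \<otimes> b"
      using g(3) by (auto simp: l_coset_def)
    have "t \<otimes> (a \<otimes> s) = t \<otimes> b" using ab AG S g t by (metis m_assoc subsetD)
    moreover have "a \<otimes> s \<in> carrier G" "b \<in> carrier G" using ab AG S g by auto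
    ultimately have "a \<otimes> s = b" using Units_l_cancel[of t "a \<otimes> s" b] t by simp
    then have "{a, a \<otimes> s} \<subseteq> A" using ab by simp
    moreover have "{a, a \<otimes> s} \<in> cayley_edges G S" using ab AG g by (auto simp: cayley_edges_def)
    ultimately show False using A by (auto simp: independent_sets_def)
  qed
  then show ?thesis using l_coset_subset_G[OF AG t]
    by (auto simp: independent_sets_def cayley_edges_def)
qed

text \<open>Preimage and image under \<open>h\<close> are mutually inverse between the independent
  sets of the image graph and those independent sets of \<open>G\<close> that are unions of
  fibres.\<close>

lemma (in group_hom) card_independent_sets_image:
  assumes surj: "h ` carrier G = carrier H" and S: "S \<subseteq> carrier G"
  shows "card (independent_sets (carrier H) (cayley_edges H (h ` S))) =
    card {A \<in> independent_sets (carrier G) (cayley_edges G S).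
      \<forall>x\<in>A. \<forall>y\<in>carrier G. h x = h y \<longrightarrow> y \<in> A}"
    (is "card ?I = card ?J")
proof (rule bij_betw_same_card)
  have edge: "h ` e \<in> cayley_edges H (h ` S)" if "e \<in> cayley_edges G S" for e
    using that S by (force simp: cayley_edges_def)
  have lift: "\<exists>g s. g \<in> carrier G \<and> s \<in> S \<and> e = {h g, h (g \<otimes> s)}"
    if e: "e \<in> cayley_edges H (h ` S)" for e
  proof -
    obtain g' s where "g' \<in> carrier H" "s \<in> S" "e = {g', g' \<otimes>\<^bsub>H\<^esub> h s}"
      using e by (auto simp: cayley_edges_def)
    moreover then obtain g where "g \<in> carrier G" "g' = h g" using surj by blast
    ultimately show ?thesis using S by (intro exI[of _ g] exI[of _ s]) auto
  qed
  show "bij_betw (\<lambda>B. {x \<in> carrier G. h x \<in> B}) ?I ?J"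
  proof (rule bij_betw_byWitness[where f' = "\<lambda>A. h ` A"])
    show "\<forall>B\<in>?I. h ` {x \<in> carrier G. h x \<in> B} = B"
      using surj by (auto simp: independent_sets_def)
    show "\<forall>A\<in>?J. {x \<in> carrier G. h x \<in> h ` A} = A"
      by (auto simp: independent_sets_def)
    show "(\<lambda>B. {x \<in> carrier G. h x \<in> B}) ` ?I \<subseteq> ?J"
    proof safe
      fix B assume B: "B \<in> ?I"
      have "\<not> e \<subseteq> {x \<in> carrier G. h x \<in> B}" if "e \<in> cayley_edges G S" for e
        using B edge[OF that] by (auto simp: independent_sets_def)
      then show "{x \<in> carrier G. h x \<in> B} \<in> independent_sets (carrier G) (cayley_edges G S)"
        by (auto simp: independent_sets_def)
    qed auto
    show "(\<lambda>A. h ` A) ` ?J \<subseteq> ?I"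
    proof safe
      fix A assume A: "A \<in> independent_sets (carrier G) (cayley_edges G S)"
        and sat: "\<forall>x\<in>A. \<forall>y\<in>carrier G. h x = h y \<longrightarrow> y \<in> A"
      have "\<not> e \<subseteq> h ` A" if e: "e \<in> cayley_edges H (h ` S)" for e
      proof
        assume sub: "e \<subseteq> h ` A"
        obtain g s where gs: "g \<in> carrier G" "s \<in> S" "e = {h g, h (g \<otimes> s)}" using lift[OF e] by blast
        moreover have "g \<otimes> s \<in> carrier G" using gs S by auto
        \<comment> \<open>The endpoints of the lifted edge are only known to lie over the image of
          \<open>A\<close>; saturation puts them into \<open>A\<close> itself.\<close>
        moreover have "g' \<in> A" if "g' \<in> carrier G" "h g' \<in> h ` A" for g'
          using sat that by (metis imageE)
        ultimately have "{g, g \<otimes> s} \<subseteq> A" using sub by blast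
        moreover have "{g, g \<otimes> s} \<in> cayley_edges G S" using gs by (auto simp: cayley_edges_def)
        ultimately show False using A by (auto simp: independent_sets_def)
      qed
      then show "h ` A \<in> ?I" using A surj by (auto simp: independent_sets_def)
    qed
  qed
qed

text \<open>An element of the kernel moves points only inside the fibres of \<open>h\<close>. So
  does its inverse, which gives the inclusion of \<open>A\<close> in its translate.\<close>

lemma (in group_hom) l_coset_fixed_of_saturated:
  assumes A: "A \<subseteq> carrier G" and t: "t \<in> carrier G" and one: "h t = \<one>\<^bsub>H\<^esub>"
    and sat: "\<forall>x\<in>A. \<forall>y\<in>carrier G. h x = h y \<longrightarrow> y \<in> A"
  shows "t <# A = A"
proof
  have "t \<otimes> a \<in> A" if a: "a \<in> A" for a
  proof (rule sat[rule_format, OF a])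
    show "t \<otimes> a \<in> carrier G" "h a = h (t \<otimes> a)" using a A t one by (simp_all add: subset_iff)
  qed
  then show "t <# A \<subseteq> A" by (auto simp: l_coset_def)
  show "A \<subseteq> t <# A"
  proof
    fix a assume a: "a \<in> A"
    then have aG: "a \<in> carrier G" using A by blast
    have "inv t \<otimes> a \<in> A" using aG t one by (intro sat[rule_format, OF a]) simp_all
    moreover have "a = t \<otimes> (inv t \<otimes> a)" using aG t by (simp add: G.m_assoc[symmetric])
    ultimately show "a \<in> t <# A" by (auto simp: l_coset_def)
  qed
qed

text \<open>Serves to pass from invariance under some elements to invariance under the subgroup that
  they generate.\<close>

lemma (in group) l_coset_stabilizer_subgroup:
  assumes "A \<subseteq> carrier G"
  shows "subgroup {g \<in> carrier G. g <# A = A} G"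
proof (rule subgroupI)
  show "{g \<in> carrier G. g <# A = A} \<noteq> {}" using lcos_mult_one[OF assms] by auto
  fix a assume a: "a \<in> {g \<in> carrier G. g <# A = A}"
  have "inv a <# (a <# A) = A" using a lcos_m_assoc[of A "inv a" a] lcos_mult_one assms by simp
  then show "inv a \<in> {g \<in> carrier G. g <# A = A}" using a by simp
  fix b assume b: "b \<in> {g \<in> carrier G. g <# A = A}"
  show "a \<otimes> b \<in> {g \<in> carrier G. g <# A = A}" using a b lcos_m_assoc[of A a b] assms by simp
qed auto

section \<open>The torus group and its standard generators\<close>

lemma torus_comm_group: "comm_group (torus_group d n)"
proof -
  interpret group "torus_group d n" by (simp add: torus_group_def)
  show ?thesis by (rule group_comm_groupI) (auto simp: torus_group_def add.commute)
qed

lemma torus_mult: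
  "x \<otimes>\<^bsub>torus_group d n\<^esub> y = (\<lambda>j\<in>{1..d}. (x j + y j) mod int n)"
  by (simp add: torus_group_def)

lemma torus_one: "\<one>\<^bsub>torus_group d n\<^esub> = (\<lambda>j\<in>{1..d}. 0)"
  by (simp add: torus_group_def)

lemma torus_carrier:
  "n > 0 \<Longrightarrow> carrier (torus_group d n) = (\<Pi>\<^sub>E j\<in>{1..d}. {0..<int n})"
  by (simp add: torus_group_def carrier_integer_mod_group)

lemma std_vec_carrier: "n > 0 \<Longrightarrow> std_vec d n i \<in> carrier (torus_group d n)"
  by (auto simp: torus_carrier std_vec_def)

lemma std_vec_pow:
  "std_vec d n i [^]\<^bsub>torus_group d n\<^esub> (k::nat) = (\<lambda>j\<in>{1..d}. if j = i then int k mod int n else 0)"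
proof -
  interpret comm_group "torus_group d n" by (rule torus_comm_group)
  show ?thesis
  proof (induction k)
    case 0
    then show ?case by (auto simp: torus_one intro!: restrict_ext)
  next
    case (Suc k)
    then show ?case
      by (auto simp: torus_mult std_vec_def mod_simps add.commute intro!: restrict_ext)
  qed
qed

lemma torus_gens_closed: "n > 0 \<Longrightarrow> torus_gens d n \<subseteq> carrier (torus_group d n)"
  using comm_group.axioms(2)[OF torus_comm_group] std_vec_carrier
  by (auto simp: torus_gens_def intro!: group.inv_closed)

lemma finite_torus_independent_sets:
  "n > 0 \<Longrightarrow> finite (independent_sets (carrier (torus_group d n)) E)"
  by (rule finite_subset[of _ "Pow (carrier (torus_group d n))"])
    (auto simp: independent_sets_def torus_carrier intro!: finite_PiE)

text \<open>Every coordinate of \<open>z\<close> is a multiple of \<open>m\<close>, so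
  \<open>z\<close> is a product of powers of the elements
  \<open>std_vec d n i [^] m\<close>.\<close>

lemma torus_subgroup_memI:
  assumes n: "n > 0" and K: "subgroup K (torus_group d n)"
    and gen: "\<And>i. i \<in> {1..d} \<Longrightarrow> std_vec d n i [^]\<^bsub>torus_group d n\<^esub> m \<in> K"
    and z: "z \<in> carrier (torus_group d n)" "\<And>j. j \<in> {1..d} \<Longrightarrow> int m dvd z j"
  shows "z \<in> K"
proof -
  interpret comm_group "torus_group d n" by (rule torus_comm_group)
  have bd: "0 \<le> z j \<and> z j < int n" if "j \<in> {1..d}" for j
    using z(1) that n by (auto simp: torus_carrier PiE_iff)
  \<comment> \<open>The coordinates are filled in one at a time; \<open>J\<close> holds those
    already done.\<close>
  have "finite J \<Longrightarrow> J \<subseteq> {1..d} \<Longrightarrow> (\<lambda>j\<in>{1..d}. if j \<in> J then z j else 0) \<in> K" for J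
  proof (induction rule: finite_induct)
    case empty
    then show ?case using subgroup.one_closed[OF K] by (simp only: torus_one empty_iff if_False)
  next
    case (insert i J)
    have i: "i \<in> {1..d}" using insert by simp
    \<comment> \<open>Representatives lie in \<open>{0..<int n}\<close>, so the quotient is
      nonnegative and can serve as a natural exponent.\<close>
    define c where "c = nat (z i div int m)"
    have "int (m * c) = z i" using z(2)[OF i] bd[OF i]
      by (simp add: c_def div_int_pos_iff)
    then have "(std_vec d n i [^]\<^bsub>torus_group d n\<^esub> m) [^]\<^bsub>torus_group d n\<^esub> c
        = (\<lambda>j\<in>{1..d}. if j = i then z i else 0)"
      using bd[OF i] by (simp only: nat_pow_pow[OF std_vec_carrier[OF n]] std_vec_pow[of d n i "m * c"])
        (auto intro!: restrict_ext)
    moreover have "(std_vec d n i [^]\<^bsub>torus_group d n\<^esub> m) [^]\<^bsub>torus_group d n\<^esub> c \<in> K"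
      using gen[OF i] subgroup.subset[OF K] K
      by (induction c) (auto simp: subgroup.one_closed subgroup.m_closed)
    moreover have "(\<lambda>j\<in>{1..d}. if j \<in> J then z j else 0) \<in> K" using insert.IH insert.prems by blast
    ultimately have "(\<lambda>j\<in>{1..d}. if j \<in> J then z j else 0) \<otimes>\<^bsub>torus_group d n\<^esub>
        (\<lambda>j\<in>{1..d}. if j = i then z i else 0) \<in> K"
      using subgroup.m_closed[OF K] by metis
    also have "(\<lambda>j\<in>{1..d}. if j \<in> J then z j else 0) \<otimes>\<^bsub>torus_group d n\<^esub>
        (\<lambda>j\<in>{1..d}. if j = i then z i else 0) = (\<lambda>j\<in>{1..d}. if j \<in> insert i J then z j else 0)"
      using insert bd by (auto simp: torus_mult intro!: restrict_ext)
    finally show ?case .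
  qed
  from this[of "{1..d}"] have "(\<lambda>j\<in>{1..d}. z j) \<in> K" by (simp cong: restrict_cong)
  moreover have "(\<lambda>j\<in>{1..d}. z j) = z"
    using z(1) by (intro extensional_restrict) (auto simp: torus_group_def PiE_def)
  ultimately show ?thesis by simp
qed

section \<open>Congruences between the counts\<close>

text \<open>The case \<open>m = 0\<close> serves for the count at \<open>p\<close> modulo
  \<open>p\<close>, the cases \<open>m \<ge> 1\<close> for the passage from \<open>p ^ m\<close> to
  \<open>p ^ Suc m\<close>.\<close>

lemma torus_indep_count_cong_fixed:
  assumes p: "prime p"
  shows "[torus_indep_count d (p ^ Suc m) =
    card {A \<in> independent_sets (carrier (torus_group d (p ^ Suc m)))
        (cayley_edges (torus_group d (p ^ Suc m)) (torus_gens d (p ^ Suc m))).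
      \<forall>i\<in>{1..d}. std_vec d (p ^ Suc m) i [^]\<^bsub>torus_group d (p ^ Suc m)\<^esub> (p ^ m)
        <#\<^bsub>torus_group d (p ^ Suc m)\<^esub> A = A}] (mod p ^ Suc m)"
proof -
  let ?n = "p ^ Suc m"
  interpret comm_group "torus_group d ?n" by (rule torus_comm_group)
  have n: "?n > 0" using p by (simp add: prime_gt_0_nat)
  let ?I = "independent_sets (carrier (torus_group d ?n))
    (cayley_edges (torus_group d ?n) (torus_gens d ?n))"
  have "[card ?I = card {A \<in> ?I. \<forall>t\<in>std_vec d ?n ` {1..d}.
      t [^]\<^bsub>torus_group d ?n\<^esub> (p ^ m) <#\<^bsub>torus_group d ?n\<^esub> A = A}] (mod ?n)"
  proof (rule card_cong_card_l_coset_fixed[OF p])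
    show "std_vec d ?n ` {1..d} \<subseteq> carrier (torus_group d ?n)" using std_vec_carrier[OF n] by blast
    show "finite ?I" by (rule finite_torus_independent_sets[OF n])
    show "t [^]\<^bsub>torus_group d ?n\<^esub> ?n = \<one>\<^bsub>torus_group d ?n\<^esub>" if "t \<in> std_vec d ?n ` {1..d}" for t
      using that by (auto simp: std_vec_pow torus_one simp del: power_Suc intro!: restrict_ext)
    show "t <#\<^bsub>torus_group d ?n\<^esub> A \<in> ?I" if "t \<in> std_vec d ?n ` {1..d}" "A \<in> ?I" for t A
      using that l_coset_independent_sets[OF torus_gens_closed[OF n]] std_vec_carrier[OF n] by blast
  qed (auto simp: independent_sets_def)
  then show ?thesis by (simp add: torus_indep_count_def del: power_Suc)
qed

text \<open>The difference of \<open>y\<close> and \<open>x\<close> has coordinates divisible by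
  \<open>m\<close>, so it lies in every subgroup that contains the \<open>m\<close>-th powers of the
  standard vectors, in particular in the stabilizer of \<open>A\<close>. This is the converse of
  \<open>l_coset_fixed_of_saturated\<close> for reduction modulo \<open>m\<close>.\<close>

lemma std_vec_fixed_saturated:
  assumes n: "n > 0" and A: "A \<subseteq> carrier (torus_group d n)"
    and fixed: "\<And>i. i \<in> {1..d} \<Longrightarrow>
      std_vec d n i [^]\<^bsub>torus_group d n\<^esub> m <#\<^bsub>torus_group d n\<^esub> A = A"
    and m: "m dvd n"
    and x: "x \<in> A" and y: "y \<in> carrier (torus_group d n)"
    and xy: "\<And>j. j \<in> {1..d} \<Longrightarrow> x j mod int m = y j mod int m"
  shows "y \<in> A"
proof -
  interpret comm_group "torus_group d n" by (rule torus_comm_group)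
  let ?K = "{g \<in> carrier (torus_group d n). g <#\<^bsub>torus_group d n\<^esub> A = A}"
  have xc: "x \<in> carrier (torus_group d n)" using x A by blast
  \<comment> \<open>Reducing the difference modulo \<open>n\<close> keeps it divisible by
    \<open>m\<close> because \<open>m dvd n\<close>.\<close>
  define z where "z = (\<lambda>j\<in>{1..d}. (y j - x j) mod int n)"
  have "z \<in> ?K"
  proof (rule torus_subgroup_memI[OF n l_coset_stabilizer_subgroup[OF A]])
    show "std_vec d n i [^]\<^bsub>torus_group d n\<^esub> m \<in> ?K" if "i \<in> {1..d}" for i
      using fixed[OF that] std_vec_carrier[OF n] by simp
    show "z \<in> carrier (torus_group d n)" using n by (auto simp: z_def torus_carrier)
    show "int m dvd z j" if "j \<in> {1..d}" for j
      using xy[OF that] that m by (simp add: z_def dvd_mod mod_eq_dvd_iff[symmetric])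
  qed
  then have "z \<otimes>\<^bsub>torus_group d n\<^esub> x \<in> A" using x by (auto simp: l_coset_def)
  moreover have "z \<otimes>\<^bsub>torus_group d n\<^esub> x = y"
  proof -
    have "z \<otimes>\<^bsub>torus_group d n\<^esub> x = (\<lambda>j\<in>{1..d}. y j)"
      using y n by (auto simp: torus_mult z_def mod_simps torus_carrier PiE_iff intro!: restrict_ext)
    then show ?thesis using y by (simp add: torus_group_def PiE_def extensional_restrict)
  qed
  ultimately show ?thesis by simp
qed

text \<open>A set invariant under all standard translations is empty or the whole group, and the
  whole group contains an edge. Only the empty set is left to count.\<close>

lemma torus_indep_count_prime:
  assumes d: "d \<ge> 1" and p: "prime p"
  shows "[torus_indep_count d p = 1] (mod p)"
proof -
  let ?G = "torus_group d p"
  interpret comm_group ?G by (rule torus_comm_group)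
  have p0: "p > 0" and p1: "p > 1" using prime_gt_1_nat[OF p] by auto
  let ?I = "independent_sets (carrier ?G) (cayley_edges ?G (torus_gens d p))"
  have "{A \<in> ?I. \<forall>i\<in>{1..d}. std_vec d p i [^]\<^bsub>?G\<^esub> (1::nat) <#\<^bsub>?G\<^esub> A = A} = {{}}"
  proof safe
    fix A x assume A: "A \<in> ?I"
      and fixed: "\<forall>i\<in>{1..d}. std_vec d p i [^]\<^bsub>?G\<^esub> (1::nat) <#\<^bsub>?G\<^esub> A = A" and x: "x \<in> A"
    have AG: "A \<subseteq> carrier ?G" using A by (simp add: independent_sets_def)
    \<comment> \<open>All integers agree modulo 1, so saturation yields every \<open>y\<close> of
      the group from the single element \<open>x\<close>.\<close>
    have mem: "y \<in> A" if "y \<in> carrier ?G" for y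
      by (rule std_vec_fixed_saturated[OF p0 AG _ _ x that, of 1]) (use fixed in auto)
    have s: "std_vec d p 1 \<in> carrier ?G" by (rule std_vec_carrier[OF p0])
    \<comment> \<open>\<open>d \<ge> 1\<close> provides a first coordinate and \<open>p > 1\<close>
      makes its entry nonzero, so this generator survives the removal of the neutral
      element.\<close>
    have "std_vec d p 1 1 \<noteq> \<one>\<^bsub>?G\<^esub> 1" using d p1 by (simp add: std_vec_def torus_one)
    then have "std_vec d p 1 \<in> torus_gens d p" using d by (auto simp: torus_gens_def)
    then have "{\<one>\<^bsub>?G\<^esub>, \<one>\<^bsub>?G\<^esub> \<otimes>\<^bsub>?G\<^esub> std_vec d p 1} \<in> cayley_edges ?G (torus_gens d p)"
      unfolding cayley_edges_def by blast
    moreover have "{\<one>\<^bsub>?G\<^esub>, \<one>\<^bsub>?G\<^esub> \<otimes>\<^bsub>?G\<^esub> std_vec d p 1} \<subseteq> A" using s mem by blast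
    ultimately show "x \<in> {}" using A by (auto simp: independent_sets_def)
  qed (auto simp: independent_sets_def cayley_edges_def l_coset_def)
  then show ?thesis using torus_indep_count_cong_fixed[OF p, of d 0] by simp
qed

lemma torus_reduction_hom:
  assumes n: "n > 0" and mn: "m dvd n"
  shows "group_hom (torus_group d n) (torus_group d m) (\<lambda>x. \<lambda>j\<in>{1..d}. x j mod int m)"
proof -
  have m: "m > 0" using n mn by (metis dvd_0_left_iff gr0I less_irrefl)
  have mn': "int m dvd int n" using mn by simp
  show ?thesis
    unfolding group_hom_def group_hom_axioms_def
  proof (intro conjI homI)
    fix x y assume "x \<in> carrier (torus_group d n)" "y \<in> carrier (torus_group d n)"
    then show "(\<lambda>j\<in>{1..d}. x j mod int m) \<in> carrier (torus_group d m)"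
      using m by (auto simp: torus_carrier)
    show "(\<lambda>j\<in>{1..d}. (x \<otimes>\<^bsub>torus_group d n\<^esub> y) j mod int m) =
      (\<lambda>j\<in>{1..d}. x j mod int m) \<otimes>\<^bsub>torus_group d m\<^esub> (\<lambda>j\<in>{1..d}. y j mod int m)"
      using mn' by (auto simp: torus_mult mod_mod_cancel mod_simps intro!: restrict_ext)
  qed (auto intro: comm_group.axioms(2)[OF torus_comm_group])
qed

lemma torus_reduction_surj:
  assumes n: "n > 0" and mn: "m dvd n"
  shows "(\<lambda>x. \<lambda>j\<in>{1..d}. x j mod int m) ` carrier (torus_group d n) = carrier (torus_group d m)"
    (is "?h ` carrier ?G = carrier ?H")
proof (intro equalityI subsetI)
  interpret group_hom ?G ?H ?h by (rule torus_reduction_hom[OF n mn])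
  show "y \<in> carrier ?H" if "y \<in> ?h ` carrier ?G" for y using that hom_closed by blast
  fix y assume y: "y \<in> carrier ?H"
  have m: "m > 0" using n mn by (metis dvd_0_left_iff gr0I less_irrefl)
  have "int m \<le> int n" using dvd_imp_le[OF mn n] by simp
  then have "{0..<int m} \<subseteq> {0..<int n}" by auto
  then have "y \<in> carrier ?G" using y PiE_mono unfolding torus_carrier[OF n] torus_carrier[OF m] by blast
  moreover have "?h y = y"
    using y unfolding torus_carrier[OF m] by (intro ext) (auto simp: PiE_iff extensional_def)
  ultimately show "y \<in> ?h ` carrier ?G" by (intro image_eqI[of y ?h y]) simp_all
qed

text \<open>For moduli at least 2 no standard vector is neutral, so \<open>torus_gens\<close> loses
  nothing by the removal of the neutral element. A homomorphism matching the standard vectors also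
  matches their inverses.\<close>

lemma torus_gens_reduction:
  assumes m: "m \<ge> 2" and n: "n \<ge> 2" and mn: "m dvd n"
  shows "(\<lambda>x. \<lambda>j\<in>{1..d}. x j mod int m) ` torus_gens d n = torus_gens d m"
proof -
  let ?h = "\<lambda>x. \<lambda>j\<in>{1..d}. x j mod int m"
  have gens: "torus_gens d k = std_vec d k ` {1..d} \<union> (\<lambda>i. inv\<^bsub>torus_group d k\<^esub> std_vec d k i) ` {1..d}"
    if k: "k \<ge> 2" for k
  proof -
    interpret comm_group "torus_group d k" by (rule torus_comm_group)
    have ne: "std_vec d k i \<noteq> \<one>\<^bsub>torus_group d k\<^esub>" if "i \<in> {1..d}" for i
    proof
      assume "std_vec d k i = \<one>\<^bsub>torus_group d k\<^esub>"
      from fun_cong[OF this, of i] show False using that k by (simp add: std_vec_def torus_one)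
    qed
    moreover have "inv\<^bsub>torus_group d k\<^esub> std_vec d k i \<noteq> \<one>\<^bsub>torus_group d k\<^esub>" if "i \<in> {1..d}" for i
      using ne[OF that] std_vec_carrier[of k d i] k by (simp add: inv_eq_1_iff)
    ultimately have "\<one>\<^bsub>torus_group d k\<^esub> \<notin> std_vec d k ` {1..d}
        \<union> (\<lambda>i. inv\<^bsub>torus_group d k\<^esub> std_vec d k i) ` {1..d}"
      by force
    then show ?thesis unfolding torus_gens_def by blast
  qed
  interpret group_hom "torus_group d n" "torus_group d m" ?h
    using n mn by (intro torus_reduction_hom) auto
  have s: "?h (std_vec d n i) = std_vec d m i" for i
    using n m mn by (auto simp: std_vec_def intro!: restrict_ext)
  have s': "?h (inv\<^bsub>torus_group d n\<^esub> std_vec d n i) = inv\<^bsub>torus_group d m\<^esub> std_vec d m i" for i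
    using hom_inv[OF std_vec_carrier[of n d i]] n unfolding s by linarith
  show ?thesis unfolding gens[OF n] gens[OF m] image_Un image_image s s' ..
qed

text \<open>Saturation under reduction modulo \<open>p ^ k\<close> amounts to invariance under the
  \<open>p ^ k\<close>-th powers of the standard vectors. The saturated independent sets count those
  of the smaller torus; the invariant ones give the larger count modulo
  \<open>p ^ Suc k\<close>.\<close>

lemma torus_indep_count_prime_power:
  assumes p: "prime p" and k: "k \<ge> 1"
  shows "[torus_indep_count d (p ^ Suc k) = torus_indep_count d (p ^ k)] (mod p ^ Suc k)"
proof -
  let ?n = "p ^ Suc k" and ?m = "p ^ k"
  let ?G = "torus_group d ?n" and ?H = "torus_group d ?m"
  let ?h = "\<lambda>x. \<lambda>j\<in>{1..d}. x j mod int ?m"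
  let ?I = "independent_sets (carrier ?G) (cayley_edges ?G (torus_gens d ?n))"
  have p2: "p \<ge> 2" using p by (rule prime_ge_2_nat)
  \<comment> \<open>Here \<open>k \<ge> 1\<close> enters: modulo \<open>p ^ 0 = 1\<close> the
    standard vectors become neutral and the edges are lost.\<close>
  have m2: "?m \<ge> 2" using self_le_power[of p k] p2 k by linarith
  have n2: "?n \<ge> 2" using self_le_power[of p "Suc k"] p2 by linarith
  have n0: "?n > 0" and mn: "?m dvd ?n" using p2 by simp_all
  interpret group_hom ?G ?H ?h by (rule torus_reduction_hom[OF n0 mn])
  have "card (independent_sets (carrier ?H) (cayley_edges ?H (?h ` torus_gens d ?n))) =
    card {A \<in> ?I. \<forall>x\<in>A. \<forall>y\<in>carrier ?G. ?h x = ?h y \<longrightarrow> y \<in> A}"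
    by (rule card_independent_sets_image[OF torus_reduction_surj[OF n0 mn] torus_gens_closed[OF n0]])
  then have "torus_indep_count d ?m = card {A \<in> ?I. \<forall>x\<in>A. \<forall>y\<in>carrier ?G. ?h x = ?h y \<longrightarrow> y \<in> A}"
    by (simp only: torus_gens_reduction[OF m2 n2 mn] torus_indep_count_def)
  also have "{A \<in> ?I. \<forall>x\<in>A. \<forall>y\<in>carrier ?G. ?h x = ?h y \<longrightarrow> y \<in> A} =
    {A \<in> ?I. \<forall>i\<in>{1..d}. std_vec d ?n i [^]\<^bsub>?G\<^esub> ?m <#\<^bsub>?G\<^esub> A = A}"
  proof (intro Collect_cong conj_cong refl iffI ballI impI)
    fix A i assume A: "A \<in> ?I" and sat: "\<forall>x\<in>A. \<forall>y\<in>carrier ?G. ?h x = ?h y \<longrightarrow> y \<in> A"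
    let ?t = "std_vec d ?n i [^]\<^bsub>?G\<^esub> ?m"
    have AG: "A \<subseteq> carrier ?G" using A by (simp add: independent_sets_def)
    have t: "?t \<in> carrier ?G" by (rule G.nat_pow_closed[OF std_vec_carrier[OF n0]])
    have one: "?h ?t = \<one>\<^bsub>?H\<^esub>"
      by (auto simp: std_vec_pow torus_one mod_mod_cancel intro!: restrict_ext)
    show "?t <#\<^bsub>?G\<^esub> A = A"
      by (rule l_coset_fixed_of_saturated[OF AG t one sat])
  next
    fix A x y assume A: "A \<in> ?I" and fixed: "\<forall>i\<in>{1..d}. std_vec d ?n i [^]\<^bsub>?G\<^esub> ?m <#\<^bsub>?G\<^esub> A = A"
      and x: "x \<in> A" and y: "y \<in> carrier ?G" and xy: "?h x = ?h y"
    have AG: "A \<subseteq> carrier ?G" using A by (simp add: independent_sets_def)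
    show "y \<in> A"
    proof (rule std_vec_fixed_saturated[OF n0 AG _ mn x y])
      show "x j mod int ?m = y j mod int ?m" if "j \<in> {1..d}" for j
        using fun_cong[OF xy, of j] that by simp
    qed (rule bspec[OF fixed])
  qed
  finally show ?thesis using torus_indep_count_cong_fixed[OF p, of d k] by (simp only:)
qed

section \<open>The $p$-adic limit\<close>

text \<open>The coset map is a ring homomorphism, so differences can be computed termwise.\<close>

lemma Qp_class_minus:
  assumes p: "prime p" and X: "padic_Cauchy p X" and Y: "padic_Cauchy p Y"
  shows "(padic_null p +>\<^bsub>padic_Cauchy_ring p\<^esub> X) \<ominus>\<^bsub>Qp p\<^esub> (padic_null p +>\<^bsub>padic_Cauchy_ring p\<^esub> Y)
    = padic_null p +>\<^bsub>padic_Cauchy_ring p\<^esub> (\<lambda>n. X n - Y n)"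
proof -
  interpret I: ideal "padic_null p" "padic_Cauchy_ring p" by (rule padic_null_ideal[OF p])
  interpret C: cring "padic_Cauchy_ring p" by (rule padic_Cauchy_ring_cring[OF p])
  interpret h: ring_hom_ring "padic_Cauchy_ring p" "Qp p" "(+>\<^bsub>padic_Cauchy_ring p\<^esub>) (padic_null p)"
    unfolding Qp_def by (rule I.rcos_ring_hom_ring)
  have inv: "\<ominus>\<^bsub>padic_Cauchy_ring p\<^esub> Y = (\<lambda>n. - Y n)"
    by (rule C.sum_zero_eq_neg[symmetric]) (use Y in \<open>auto simp: padic_Cauchy_minus\<close>)
  have "(padic_null p +>\<^bsub>padic_Cauchy_ring p\<^esub> X) \<ominus>\<^bsub>Qp p\<^esub> (padic_null p +>\<^bsub>padic_Cauchy_ring p\<^esub> Y)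
    = padic_null p +>\<^bsub>padic_Cauchy_ring p\<^esub> (X \<oplus>\<^bsub>padic_Cauchy_ring p\<^esub> \<ominus>\<^bsub>padic_Cauchy_ring p\<^esub> Y)"
    using X Y h.hom_add[of X "\<ominus>\<^bsub>padic_Cauchy_ring p\<^esub> Y"] h.hom_a_inv[of Y]
    by (simp add: a_minus_def inv padic_Cauchy_minus)
  then show ?thesis by (simp add: inv)
qed

lemma padic_val_class:
  assumes p: "prime p" and X: "padic_Cauchy p X" and v: "(\<lambda>n. rat_pval p (X n)) \<longlonglongrightarrow> v"
  shows "padic_val p (padic_null p +>\<^bsub>padic_Cauchy_ring p\<^esub> X) = v"
proof -
  interpret ideal "padic_null p" "padic_Cauchy_ring p" by (rule padic_null_ideal[OF p])
  show ?thesis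
    by (rule padic_val_eqI[OF p _ _ v]) (use X in \<open>auto simp: Qp_carrier intro!: a_rcos_self\<close>)
qed

text \<open>The valuations along a Cauchy sequence converge, and an eventual lower bound passes to
  the limit.\<close>

lemma padic_val_class_ge:
  assumes p: "prime p" and X: "padic_Cauchy p X" and N: "\<And>n. n \<ge> N \<Longrightarrow> e \<le> rat_pval p (X n)"
  shows "e \<le> padic_val p (padic_null p +>\<^bsub>padic_Cauchy_ring p\<^esub> X)"
proof -
  obtain v where v: "(\<lambda>n. rat_pval p (X n)) \<longlonglongrightarrow> v"
    using padic_Cauchy_pval_convergent[OF p X] .
  have "e \<le> v" by (rule LIMSEQ_le_const[OF v]) (use N in blast)
  then show ?thesis using padic_val_class[OF p X v] by simp
qed

lemma rat_pval_prime_power: "prime p \<Longrightarrow> rat_pval p (of_nat (p ^ k)) = ereal (real k)"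
proof -
  assume p: "prime p"
  then have "int p ^ k \<noteq> 0" "prime_elem (int p)" "p \<noteq> 1" by (auto simp: prime_gt_0_nat)
  then show ?thesis using rat_pval_of_int[OF p, of "int p ^ k"] by (simp add: multiplicity_same_power')
qed

lemma rat_pval_ge_of_dvd:
  assumes p: "prime p" and "int p ^ k dvd a"
  shows "ereal (real k) \<le> rat_pval p (of_int a)"
proof (cases "a = 0")
  case False
  have "k \<le> multiplicity (int p) a"
    using assms False p by (intro multiplicity_geI) (auto simp: prime_gt_1_nat)
  then show ?thesis using rat_pval_of_int[OF p False] by simp
qed simp

text \<open>Termwise division by \<open>p ^ k\<close> gives a Cauchy sequence with eventually
  nonnegative valuations; its class is the cofactor in \<open>Zp p\<close>.\<close>

lemma pow_Zp_class:
  assumes p: "prime p" and X: "padic_Cauchy p X"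
    and N: "\<And>n. n \<ge> N \<Longrightarrow> ereal (real k) \<le> rat_pval p (X n)"
  shows "padic_null p +>\<^bsub>padic_Cauchy_ring p\<^esub> X \<in> pow_Zp p k"
proof -
  interpret I: ideal "padic_null p" "padic_Cauchy_ring p" by (rule padic_null_ideal[OF p])
  interpret C: cring "padic_Cauchy_ring p" by (rule padic_Cauchy_ring_cring[OF p])
  interpret h: ring_hom_ring "padic_Cauchy_ring p" "Qp p" "(+>\<^bsub>padic_Cauchy_ring p\<^esub>) (padic_null p)"
    unfolding Qp_def by (rule I.rcos_ring_hom_ring)
  define Y where "Y n = inverse (of_nat (p ^ k)) * X n" for n
  have Y: "padic_Cauchy p Y"
    unfolding Y_def by (rule padic_Cauchy_mult[OF p padic_Cauchy_const X])
  have XY: "X = (\<lambda>n. of_nat (p ^ k) * Y n)"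
    using p by (auto simp: Y_def prime_gt_0_nat)
  have "0 \<le> rat_pval p (Y n)" if "n \<ge> N" for n
  proof -
    have "ereal (real k) \<le> ereal (real k) + rat_pval p (Y n)"
      using N[OF that] by (simp add: XY rat_pval_mult[OF p] rat_pval_prime_power[OF p] del: of_nat_power)
    then show ?thesis by (cases "rat_pval p (Y n)") auto
  qed
  then have "padic_null p +>\<^bsub>padic_Cauchy_ring p\<^esub> Y \<in> Zp p"
    using padic_val_class_ge[OF p Y] Y by (auto simp: Zp_def Qp_carrier)
  moreover have "padic_of_rat p (of_nat (p ^ k)) \<otimes>\<^bsub>Qp p\<^esub> (padic_null p +>\<^bsub>padic_Cauchy_ring p\<^esub> Y)
      = padic_null p +>\<^bsub>padic_Cauchy_ring p\<^esub> X"
    using h.hom_mult[of "\<lambda>_. of_nat (p ^ k)" Y] Y XY by (simp add: padic_of_rat_def)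
  ultimately show ?thesis by (auto simp: pow_Zp_def l_coset_def)
qed

lemma Qp_one: "\<one>\<^bsub>Qp p\<^esub> = padic_of_rat p 1"
  by (simp add: Qp_def FactRing_def padic_of_rat_def)

text \<open>The congruences telescope: \<open>a n\<close> agrees with \<open>a k\<close> modulo
  \<open>p ^ k\<close> for all \<open>n \<ge> k \<ge> 1\<close>. This gives both the Cauchy property
  and the rate of convergence. The last claim is meant for tame primes: valuations that are constant
  along the sequence pass to the limit.\<close>

lemma padic_limit_of_congruences:
  fixes a :: "nat \<Rightarrow> nat"
  assumes p: "prime p" and step: "\<And>k. k \<ge> 1 \<Longrightarrow> [a (Suc k) = a k] (mod p ^ k)"
    and one: "[a 1 = 1] (mod p)"
  obtains \<kappa> where "\<kappa> \<in> pow_Zp p 1 +>\<^bsub>Qp p\<^esub> \<one>\<^bsub>Qp p\<^esub>"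
    and "padic_tendsto p (\<lambda>k. padic_of_rat p (of_nat (a k))) \<kappa>"
    and "\<And>k. k \<ge> 1 \<Longrightarrow> padic_cong p k (padic_of_rat p (of_nat (a k))) \<kappa>"
    and "(\<And>k. k \<ge> 1 \<Longrightarrow> padic_val p (padic_of_rat p (of_nat (a k)) \<ominus>\<^bsub>Qp p\<^esub> \<one>\<^bsub>Qp p\<^esub>)
          = padic_val p (padic_of_rat p (of_nat (a 1)) \<ominus>\<^bsub>Qp p\<^esub> \<one>\<^bsub>Qp p\<^esub>)) \<Longrightarrow>
        padic_val p (\<kappa> \<ominus>\<^bsub>Qp p\<^esub> \<one>\<^bsub>Qp p\<^esub>) =
          padic_val p (padic_of_rat p (of_nat (a 1)) \<ominus>\<^bsub>Qp p\<^esub> \<one>\<^bsub>Qp p\<^esub>)"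
proof -
  \<comment> \<open>The sequence \<open>a\<close>, read as a Cauchy sequence of rationals, represents its own limit.\<close>
  interpret Q: cring "Qp p" by (rule Qp_cring[OF p])
  let ?c = "\<lambda>X. padic_null p +>\<^bsub>padic_Cauchy_ring p\<^esub> X"
  define X where "X k = (of_nat (a k) :: rat)" for k
  have pval_of_cong: "ereal (real k) \<le> rat_pval p (of_nat b - of_nat c)"
    if "[b = c] (mod p ^ k)" for k b c
  proof -
    have "int p ^ k dvd int b - int c"
      using that by (metis cong_iff_dvd_diff cong_int_iff of_nat_power)
    from rat_pval_ge_of_dvd[OF p this] show ?thesis by simp
  qed
  have cong: "[a n = a k] (mod p ^ k)" if "k \<le> n" "k \<ge> 1" for n k
    using that(1)
  proof (induction n rule: dec_induct)
    case (step n)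
    \<comment> \<open>The given congruence holds modulo \<open>p ^ n\<close>, a multiple of
      \<open>p ^ k\<close> since \<open>k \<le> n\<close>.\<close>
    then have "[a (Suc n) = a n] (mod p ^ k)"
      using assms(2)[of n] that by (meson cong_dvd_modulus_nat le_imp_power_dvd le_trans)
    then show ?case using step.IH cong_trans by blast
  qed simp
  have close: "ereal (real k) \<le> rat_pval p (X n - X k)" if "k \<le> n" "k \<ge> 1" for n k
    unfolding X_def by (rule pval_of_cong[OF cong[OF that]])
  have close1: "ereal (real 1) \<le> rat_pval p (X n - 1)" if "n \<ge> 1" for n
    using pval_of_cong[of "a n" 1 1] cong_trans[OF cong[OF that order_refl, unfolded power_one_right] one]
    by (simp add: X_def)
  have X: "padic_Cauchy p X"
    unfolding padic_Cauchy_def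
  proof
    fix r :: real
    \<comment> \<open>The successor keeps \<open>N\<close> positive, as the congruences start at
      index 1.\<close>
    define N where "N = Suc (nat \<lceil>r\<rceil>)"
    have rN: "ereal r \<le> ereal (real N)" unfolding N_def using real_nat_ceiling_ge[of r] by simp
    have "ereal r \<le> rat_pval p (X i - X j)" if "i \<ge> N" "j \<ge> N" for i j
    proof -
      \<comment> \<open>Both terms are compared with \<open>X N\<close>; the ultrametric inequality
        preserves the bound.\<close>
      have "ereal (real N) \<le> rat_pval p ((X i - X N) + (X N - X j))"
        using close[of N i] close[of N j] that
        by (intro rat_pval_add_ge[OF p]) (auto simp: N_def rat_pval_diff_commute)
      then show ?thesis using order_trans[OF rN] by simp
    qed
    then show "\<exists>N. \<forall>i\<ge>N. \<forall>j\<ge>N. ereal r \<le> rat_pval p (X i - X j)" by blast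
  qed
  have diff: "padic_of_rat p (of_nat (a k)) \<ominus>\<^bsub>Qp p\<^esub> ?c X = ?c (\<lambda>n. X k - X n)" for k
    using Qp_class_minus[OF p padic_Cauchy_const X] by (simp add: padic_of_rat_def X_def)
  have cd: "padic_Cauchy p (\<lambda>n. X k - X n)" for k
    using padic_Cauchy_add[OF p padic_Cauchy_const padic_Cauchy_minus[OF X]] by simp
  have diff1: "?c X \<ominus>\<^bsub>Qp p\<^esub> \<one>\<^bsub>Qp p\<^esub> = ?c (\<lambda>n. X n - 1)"
    using Qp_class_minus[OF p X padic_Cauchy_const] by (simp add: Qp_one padic_of_rat_def)
  have c1: "padic_Cauchy p (\<lambda>n. X n - 1)"
    using padic_Cauchy_add[OF p X padic_Cauchy_const[of p "-1"]] by simp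
  have int: "0 \<le> rat_pval p (X n)" for n
    using rat_pval_ge_of_dvd[OF p, of 0 "int (a n)"] by (simp add: X_def zero_ereal_def)
  have XQ: "?c X \<in> carrier (Qp p)" using X by (auto simp: Qp_carrier)
  have XZ: "?c X \<in> Zp p" using padic_val_class_ge[OF p X int] XQ by (simp add: Zp_def)
  have aZ: "padic_of_rat p (of_nat (a k)) \<in> Zp p" for k
    using int[of k] by (simp add: Zp_def padic_val_of_rat[OF p] X_def)
  show ?thesis
  proof
    have "?c X = (?c X \<ominus>\<^bsub>Qp p\<^esub> \<one>\<^bsub>Qp p\<^esub>) \<oplus>\<^bsub>Qp p\<^esub> \<one>\<^bsub>Qp p\<^esub>"
      using XQ by (simp add: a_minus_def Q.a_assoc Q.l_neg)
    \<comment> \<open>From index 1 on every term is 1 modulo \<open>p\<close>, so the termwise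
      difference has valuation at least 1.\<close>
    moreover have "?c X \<ominus>\<^bsub>Qp p\<^esub> \<one>\<^bsub>Qp p\<^esub> \<in> pow_Zp p 1"
      unfolding diff1 by (rule pow_Zp_class[OF p c1 close1])
    ultimately show "?c X \<in> pow_Zp p 1 +>\<^bsub>Qp p\<^esub> \<one>\<^bsub>Qp p\<^esub>"
      unfolding a_r_coset_def' by blast
  next
    \<comment> \<open>With \<open>k\<close> fixed, the representing sequence
      \<open>X k - X n\<close> has valuation at least \<open>k\<close> from \<open>n = k\<close>
      on.\<close>
    have ge: "ereal (real k) \<le> padic_val p (padic_of_rat p (of_nat (a k)) \<ominus>\<^bsub>Qp p\<^esub> ?c X)"
      if "k \<ge> 1" for k
      unfolding diff by (rule padic_val_class_ge[OF p cd, of k])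
        (use close that in \<open>simp add: rat_pval_diff_commute[of p "X k"]\<close>)
    have "(\<lambda>k. padic_val p (padic_of_rat p (of_nat (a k)) \<ominus>\<^bsub>Qp p\<^esub> ?c X)) \<longlonglongrightarrow> \<infinity>"
      unfolding tendsto_PInfty
    proof
      fix r :: real
      have "ereal r < padic_val p (padic_of_rat p (of_nat (a k)) \<ominus>\<^bsub>Qp p\<^esub> ?c X)"
        if "k \<ge> Suc (nat \<lceil>r\<rceil>)" for k
      proof -
        have "r < real k" using that real_nat_ceiling_ge[of r] by linarith
        then have "ereal r < ereal (real k)" by simp
        also have "\<dots> \<le> padic_val p (padic_of_rat p (of_nat (a k)) \<ominus>\<^bsub>Qp p\<^esub> ?c X)"
          using ge that by simp
        finally show ?thesis .
      qed
      then show "\<forall>\<^sub>F k in sequentially.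
          ereal r < padic_val p (padic_of_rat p (of_nat (a k)) \<ominus>\<^bsub>Qp p\<^esub> ?c X)"
        unfolding eventually_sequentially by blast
    qed
    then show "padic_tendsto p (\<lambda>k. padic_of_rat p (of_nat (a k))) (?c X)"
      using XQ by (auto simp: padic_tendsto_def)
  next
    fix k :: nat assume k: "k \<ge> 1"
    have "?c (\<lambda>n. X k - X n) \<in> pow_Zp p k"
      by (rule pow_Zp_class[OF p cd, of k])
        (use close k in \<open>simp add: rat_pval_diff_commute[of p "X k"]\<close>)
    then show "padic_cong p k (padic_of_rat p (of_nat (a k))) (?c X)"
      using aZ XZ diff by (simp add: padic_cong_def)
  next
    have val: "padic_val p (padic_of_rat p (of_nat (a k)) \<ominus>\<^bsub>Qp p\<^esub> \<one>\<^bsub>Qp p\<^esub>) = rat_pval p (X k - 1)" for k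
    proof -
      have "padic_of_rat p (of_nat (a k)) \<ominus>\<^bsub>Qp p\<^esub> \<one>\<^bsub>Qp p\<^esub> = padic_of_rat p (X k - 1)"
        using Qp_class_minus[OF p padic_Cauchy_const padic_Cauchy_const]
        by (simp add: Qp_one padic_of_rat_def X_def)
      then show ?thesis by (simp add: padic_val_of_rat[OF p])
    qed
    assume "\<And>k. k \<ge> 1 \<Longrightarrow> padic_val p (padic_of_rat p (of_nat (a k)) \<ominus>\<^bsub>Qp p\<^esub> \<one>\<^bsub>Qp p\<^esub>)
          = padic_val p (padic_of_rat p (of_nat (a 1)) \<ominus>\<^bsub>Qp p\<^esub> \<one>\<^bsub>Qp p\<^esub>)"
    \<comment> \<open>The valuations are constant from index 1 on, so the limit has the valuation,
      possibly infinite, found at index 1.\<close>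
    then have "\<forall>\<^sub>F n in sequentially. rat_pval p (X n - 1) = rat_pval p (X 1 - 1)"
      unfolding val eventually_sequentially by blast
    then have "padic_val p (?c (\<lambda>n. X n - 1)) = rat_pval p (X 1 - 1)"
      by (intro padic_val_class[OF p c1] tendsto_eventually)
    then show "padic_val p (?c X \<ominus>\<^bsub>Qp p\<^esub> \<one>\<^bsub>Qp p\<^esub>) =
          padic_val p (padic_of_rat p (of_nat (a 1)) \<ominus>\<^bsub>Qp p\<^esub> \<one>\<^bsub>Qp p\<^esub>)"
      by (simp only: diff1 val)
  qed
qed

theorem proposition4p1:
  fixes d p :: nat
  assumes "d \<ge> 1" and "prime p"
  shows "\<exists>\<kappa>. \<kappa> \<in> pow_Zp p 1 +>\<^bsub>Qp p\<^esub> \<one>\<^bsub>Qp p\<^esub>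
    \<and> padic_tendsto p (\<lambda>k. padic_indep_count p d (p ^ k)) \<kappa>
    \<and> (\<forall>k\<ge>1. padic_cong p k (padic_indep_count p d (p ^ k)) \<kappa>)
    \<and> (p \<in> Tame d \<longrightarrow>
         padic_val p (\<kappa> \<ominus>\<^bsub>Qp p\<^esub> \<one>\<^bsub>Qp p\<^esub>)
           = padic_val p (padic_indep_count p d p \<ominus>\<^bsub>Qp p\<^esub> \<one>\<^bsub>Qp p\<^esub>))"
proof -
  let ?a = "\<lambda>k. torus_indep_count d (p ^ k)"
  \<comment> \<open>The modulus \<open>p ^ Suc k\<close> is weakened to \<open>p ^ k\<close>, which
    suffices for the claimed rate.\<close>
  have step: "[?a (Suc k) = ?a k] (mod p ^ k)" if "k \<ge> 1" for k
    using torus_indep_count_prime_power[OF assms(2) that] by (rule cong_dvd_modulus_nat) simp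
  have one: "[?a 1 = 1] (mod p)"
    using torus_indep_count_prime[OF assms] by simp
  show ?thesis
  proof (rule padic_limit_of_congruences[OF assms(2), of ?a], goal_cases)
    case (1 k)
    then show ?case by (rule step)
  next
    case 2
    show ?case by (rule one)
  next
    case (3 \<kappa>)
    then show ?case
      by (intro exI[of _ \<kappa>]) (simp add: padic_indep_count_def Tame_def)
  qed
qed

end
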